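(* Let $A$ be a monoid. Then there is a bijection between isomorphism classes of skew monoidal monoids $\langle A,T,Q,\mu,\eta,\delta,\varepsilon\rangle$ with underlying monoid $A$ and isomorphism classes of source-regular right bialgebroids $\langle G,A,s^G,t^G,\Delta^G,\epsilon^G\rangle$ over $A$.
   Context: A skew monoidal monoid $\langle A,T,Q,\gamma,\eta,\varepsilon\rangle$ consists of a monoid $A$, monoid endomorphisms $T,Q:A\to A$ and elements $\gamma,\eta,\varepsilon\in A$ such that for all $a,b\in A$: $T(a)Q(b)=Q(b)T(a)$, $\gamma T^2(a)=T(a)\gamma$, $\gamma TQ(a)=QT(a)\gamma$, $\gamma Q(a)=Q^2(a)\gamma$, $\eta a=T(a)\eta$, $a\varepsilon=\varepsilon Q(a)$, $Q(\gamma)\gamma T(\gamma)=\gamma^2$, $\gamma\eta=Q(\eta)$, $\varepsilon\gamma=T(\varepsilon)$, $Q(\varepsilon)\gamma T(\eta)=1$, $\varepsilon\eta=1$. It is equivalently presented as $\langle A,T,Q,\mu,\eta,\delta,\varepsilon\rangle$ with $\mu:=Q(\varepsilon)\gamma$ and $\delta:=\gamma T(\eta)$; then $\gamma=\mu\delta$. An isomorphism of skew monoidal monoids $\langle A,T,Q,\gamma,\eta,\varepsilon\rangle\to\langle A',T',Q',\gamma',\eta',\varepsilon'\rangle$ is a triple $\langle\phi,\phi_2,\phi_0\rangle$ where $\phi:A\to A'$ is an isomorphism of monoids and $\phi_2,\phi_0\in A'$ are invertible elements such that for all $a\in A$: $\phi_2Q'(\phi(a))=\phi(Q(a))\phi_2$,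 $\phi_2T'(\phi(a))=\phi(T(a))\phi_2$, $\phi(\gamma)\phi_2T'(\phi_2)=\phi_2Q'(\phi_2)\gamma'$, $\phi_2Q'(\phi_0)\eta'=\phi(\eta)$, $\phi(\varepsilon)\phi_2T'(\phi_0)=\varepsilon'$. A right $A$-bialgebroid (over a monoid $A$, in sets) is a monoid $G$ with monoid morphisms $s^G:A\to G$ (source), $t^G:A^{\mathrm{op}}\to G$ (target) whose images commute, together with a comonoid structure $\Delta^G:G\to G\otimes_AG$, $g\mapsto g^{(1)}\otimes g^{(2)}$, $\epsilon^G:G\to A$ in the monoidal category of $A$-$A$-bisets, where $G$ is a bimodule by $a_1\cdot g\cdot a_2=g\,t^G(a_1)s^G(a_2)$, such that for all $a\in A$, $g,h\in G$: $s^G(a)g^{(1)}\otimes g^{(2)}=g^{(1)}\otimes t^G(a)g^{(2)}$, $\Delta^G(gh)=g^{(1)}h^{(1)}\otimes g^{(2)}h^{(2)}$, $\Delta^G(1)=1\otimes1$, $\epsilon^G(1)=1$, $\epsilon^G(s^G(\epsilon^G(g))h)=\epsilon^G(gh)=\epsilon^G(t^G(\epsilon^G(g))h)$. It is source-regular if $G$, with right $A$-action $g\cdot a=gs^G(a)$, is isomorphic to the right regular $A$-module $A_A$ (i.e. is free of rank 1). An isomorphism of bialgebroids from $G$ over $A$ to $G'$ over $A'$ is a pair of monoid isomorphisms $\varphi:G\to G'$, $\varphi_0:A\to A'$ with $\varphi(s^G(a))=s^{G'}(\varphi_0(a))$, $\varphi(t^G(a))=t^{G'}(\varphi_0(a))$,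 $\epsilon^{G'}(\varphi(g))=\varphi_0(\epsilon^G(g))$, $\Delta^{G'}(\varphi(g))=\varphi(g^{(1)})\otimes_{A'}\varphi(g^{(2)})$. *)

theory Defs
  imports "HOL-Algebra.Group" "HOL-Library.Equipollence"
begin

section \<open>Monoid morphisms\<close>

text \<open>\<open>hom\<close> of HOL-Algebra does not ask for preservation of the unit; for \<open>iso\<close> it is automatic.\<close>

definition monoid_hom :: "('a, 'm) monoid_scheme \<Rightarrow> ('b, 'n) monoid_scheme \<Rightarrow> ('a \<Rightarrow> 'b) set" where
  "monoid_hom A B = {h \<in> hom A B. h \<one>\<^bsub>A\<^esub> = \<one>\<^bsub>B\<^esub>}"

definition op_monoid :: "('a, 'm) monoid_scheme \<Rightarrow> 'a monoid" where
  "op_monoid A = \<lparr>carrier = carrier A, mult = (\<lambda>a b. b \<otimes>\<^bsub>A\<^esub> a), one = \<one>\<^bsub>A\<^esub>\<rparr>"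


section \<open>Skew monoidal monoids\<close>

record 'a smm =
  smm_T :: "'a \<Rightarrow> 'a"
  smm_Q :: "'a \<Rightarrow> 'a"
  smm_gamma :: 'a
  smm_eta :: 'a
  smm_eps :: 'a

locale skew_monoidal_monoid = monoid A for A :: "('a, 'm) monoid_scheme" (structure) +
  fixes S :: "'a smm"
  assumes T_hom: "smm_T S \<in> monoid_hom A A"
    and Q_hom: "smm_Q S \<in> monoid_hom A A"
    and gamma_closed: "smm_gamma S \<in> carrier A"
    and eta_closed: "smm_eta S \<in> carrier A"
    and eps_closed: "smm_eps S \<in> carrier A"
    and T_Q_commute: "\<lbrakk>a \<in> carrier A; b \<in> carrier A\<rbrakk> \<Longrightarrow>
          smm_T S a \<otimes> smm_Q S b = smm_Q S b \<otimes> smm_T S a"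
    and gamma_TT: "a \<in> carrier A \<Longrightarrow>
          smm_gamma S \<otimes> smm_T S (smm_T S a) = smm_T S a \<otimes> smm_gamma S"
    and gamma_TQ: "a \<in> carrier A \<Longrightarrow>
          smm_gamma S \<otimes> smm_T S (smm_Q S a) = smm_Q S (smm_T S a) \<otimes> smm_gamma S"
    and gamma_Q: "a \<in> carrier A \<Longrightarrow>
          smm_gamma S \<otimes> smm_Q S a = smm_Q S (smm_Q S a) \<otimes> smm_gamma S"
    and eta_nat: "a \<in> carrier A \<Longrightarrow> smm_eta S \<otimes> a = smm_T S a \<otimes> smm_eta S"
    and eps_nat: "a \<in> carrier A \<Longrightarrow> a \<otimes> smm_eps S = smm_eps S \<otimes> smm_Q S a"
    and pentagon: "smm_Q S (smm_gamma S) \<otimes> smm_gamma S \<otimes> smm_T S (smm_gamma S)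
          = smm_gamma S \<otimes> smm_gamma S"
    and gamma_eta: "smm_gamma S \<otimes> smm_eta S = smm_Q S (smm_eta S)"
    and eps_gamma: "smm_eps S \<otimes> smm_gamma S = smm_T S (smm_eps S)"
    and triangle: "smm_Q S (smm_eps S) \<otimes> smm_gamma S \<otimes> smm_T S (smm_eta S) = \<one>"
    and eps_eta: "smm_eps S \<otimes> smm_eta S = \<one>"

definition smm_isomorphism ::
  "('a, 'm) monoid_scheme \<Rightarrow> 'a smm \<Rightarrow> ('b, 'n) monoid_scheme \<Rightarrow> 'b smm \<Rightarrow>
   ('a \<Rightarrow> 'b) \<Rightarrow> 'b \<Rightarrow> 'b \<Rightarrow> bool" where
  "smm_isomorphism A S A' S' \<phi> \<phi>\<^sub>2 \<phi>\<^sub>0 \<longleftrightarrow>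
     \<phi> \<in> iso A A' \<and> \<phi>\<^sub>2 \<in> Units A' \<and> \<phi>\<^sub>0 \<in> Units A' \<and>
     (\<forall>a \<in> carrier A. \<phi>\<^sub>2 \<otimes>\<^bsub>A'\<^esub> smm_Q S' (\<phi> a) = \<phi> (smm_Q S a) \<otimes>\<^bsub>A'\<^esub> \<phi>\<^sub>2) \<and>
     (\<forall>a \<in> carrier A. \<phi>\<^sub>2 \<otimes>\<^bsub>A'\<^esub> smm_T S' (\<phi> a) = \<phi> (smm_T S a) \<otimes>\<^bsub>A'\<^esub> \<phi>\<^sub>2) \<and>
     \<phi> (smm_gamma S) \<otimes>\<^bsub>A'\<^esub> \<phi>\<^sub>2 \<otimes>\<^bsub>A'\<^esub> smm_T S' \<phi>\<^sub>2
       = \<phi>\<^sub>2 \<otimes>\<^bsub>A'\<^esub> smm_Q S' \<phi>\<^sub>2 \<otimes>\<^bsub>A'\<^esub> smm_gamma S' \<and>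
     \<phi>\<^sub>2 \<otimes>\<^bsub>A'\<^esub> smm_Q S' \<phi>\<^sub>0 \<otimes>\<^bsub>A'\<^esub> smm_eta S' = \<phi> (smm_eta S) \<and>
     \<phi> (smm_eps S) \<otimes>\<^bsub>A'\<^esub> \<phi>\<^sub>2 \<otimes>\<^bsub>A'\<^esub> smm_T S' \<phi>\<^sub>0 = smm_eps S'"

text \<open>
  The equivalent presentation \<open>\<langle>A,T,Q,\<mu>,\<eta>,\<delta>,\<epsilon>\<rangle>\<close>: a tuple is a skew monoidal monoid in this
  presentation if it arises from one in the presentation with \<open>\<gamma>\<close>, which is recovered as
  \<open>\<gamma> = \<mu>\<delta>\<close>; isomorphisms are those of the \<open>\<gamma>\<close>-presentations.
\<close>

record 'a smm_md =
  md_T :: "'a \<Rightarrow> 'a"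
  md_Q :: "'a \<Rightarrow> 'a"
  md_mu :: 'a
  md_eta :: 'a
  md_delta :: 'a
  md_eps :: 'a

definition md_of_smm :: "('a, 'm) monoid_scheme \<Rightarrow> 'a smm \<Rightarrow> 'a smm_md" where
  "md_of_smm A S =
     \<lparr>md_T = smm_T S, md_Q = smm_Q S,
      md_mu = smm_Q S (smm_eps S) \<otimes>\<^bsub>A\<^esub> smm_gamma S, md_eta = smm_eta S,
      md_delta = smm_gamma S \<otimes>\<^bsub>A\<^esub> smm_T S (smm_eta S), md_eps = smm_eps S\<rparr>"

definition smm_of_md :: "('a, 'm) monoid_scheme \<Rightarrow> 'a smm_md \<Rightarrow> 'a smm" where
  "smm_of_md A M =
     \<lparr>smm_T = md_T M, smm_Q = md_Q M, smm_gamma = md_mu M \<otimes>\<^bsub>A\<^esub> md_delta M,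
      smm_eta = md_eta M, smm_eps = md_eps M\<rparr>"

lemma (in skew_monoidal_monoid) smm_of_md_of_smm: "smm_of_md A (md_of_smm A S) = S"
proof -
  let ?T = "smm_T S" and ?Q = "smm_Q S" and ?g = "smm_gamma S"
    and ?n = "smm_eta S" and ?e = "smm_eps S"
  note cl = gamma_closed eta_closed eps_closed
  have Tc: "?T a \<in> carrier A" and Qc: "?Q a \<in> carrier A" if "a \<in> carrier A" for a
    using that T_hom Q_hom by (auto simp: monoid_hom_def hom_def)
  have Tm: "?T (a \<otimes> b) = ?T a \<otimes> ?T b" and Qm: "?Q (a \<otimes> b) = ?Q a \<otimes> ?Q b"
    if "a \<in> carrier A" "b \<in> carrier A" for a b
    using that T_hom Q_hom by (auto simp: monoid_hom_def hom_def)
  have one: "?T \<one> = \<one>" using T_hom by (simp add: monoid_hom_def)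
  have "(?Q ?e \<otimes> ?g) \<otimes> (?g \<otimes> ?T ?n) = ?Q ?e \<otimes> (?g \<otimes> ?g) \<otimes> ?T ?n"
    by (simp add: m_assoc cl Tc Qc)
  also have "\<dots> = ?Q (?e \<otimes> ?g) \<otimes> ?g \<otimes> ?T (?g \<otimes> ?n)"
    by (simp add: pentagon [symmetric] m_assoc cl Tc Qc Tm Qm)
  also have "\<dots> = ?g \<otimes> ?T (?Q ?e) \<otimes> ?T (?Q ?n)"
    by (simp add: eps_gamma gamma_eta gamma_TQ cl)
  also have "\<dots> = ?g \<otimes> ?T (?Q (?e \<otimes> ?n))"
    by (simp add: m_assoc cl Tc Qc Tm Qm)
  also have "\<dots> = ?g"
    using Q_hom by (simp add: eps_eta one cl monoid_hom_def)
  finally show ?thesis by (simp add: smm_of_md_def md_of_smm_def)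
qed

definition smm_mds :: "('a, 'm) monoid_scheme \<Rightarrow> 'a smm_md set" where
  "smm_mds A = md_of_smm A ` {S. skew_monoidal_monoid A S}"

text \<open>The isomorphisms may involve a nontrivial automorphism \<open>\<phi>\<close> of the underlying monoid.\<close>

definition smm_iso_rel :: "('a, 'm) monoid_scheme \<Rightarrow> ('a smm_md \<times> 'a smm_md) set" where
  "smm_iso_rel A = {(M, M'). M \<in> smm_mds A \<and> M' \<in> smm_mds A \<and>
     (\<exists>\<phi> \<phi>\<^sub>2 \<phi>\<^sub>0. smm_isomorphism A (smm_of_md A M) A (smm_of_md A M') \<phi> \<phi>\<^sub>2 \<phi>\<^sub>0)}"

definition smm_iso_classes :: "('a, 'm) monoid_scheme \<Rightarrow> 'a smm_md set set" where
  "smm_iso_classes A = smm_mds A // smm_iso_rel A"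


section \<open>The monoidal category of bisets\<close>

record ('a, 'x) biset =
  points :: "'x set"
  lact :: "'a \<Rightarrow> 'x \<Rightarrow> 'x"
  ract :: "'x \<Rightarrow> 'a \<Rightarrow> 'x"

locale biset = monoid A for A :: "('a, 'm) monoid_scheme" (structure) +
  fixes X :: "('a, 'x) biset"
  assumes lact_closed: "\<lbrakk>a \<in> carrier A; x \<in> points X\<rbrakk> \<Longrightarrow> lact X a x \<in> points X"
    and ract_closed: "\<lbrakk>x \<in> points X; a \<in> carrier A\<rbrakk> \<Longrightarrow> ract X x a \<in> points X"
    and lact_one: "x \<in> points X \<Longrightarrow> lact X \<one> x = x"
    and ract_one: "x \<in> points X \<Longrightarrow> ract X x \<one> = x"
    and lact_mult: "\<lbrakk>a \<in> carrier A; b \<in> carrier A; x \<in> points X\<rbrakk> \<Longrightarrow>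
          lact X (a \<otimes> b) x = lact X a (lact X b x)"
    and ract_mult: "\<lbrakk>x \<in> points X; a \<in> carrier A; b \<in> carrier A\<rbrakk> \<Longrightarrow>
          ract X x (a \<otimes> b) = ract X (ract X x a) b"
    and lact_ract: "\<lbrakk>a \<in> carrier A; x \<in> points X; b \<in> carrier A\<rbrakk> \<Longrightarrow>
          ract X (lact X a x) b = lact X a (ract X x b)"

definition regular_biset :: "('a, 'm) monoid_scheme \<Rightarrow> ('a, 'a) biset" where
  "regular_biset A = \<lparr>points = carrier A, lact = mult A, ract = mult A\<rparr>"

definition biset_hom ::
  "('a, 'm) monoid_scheme \<Rightarrow> ('a, 'x) biset \<Rightarrow> ('a, 'y) biset \<Rightarrow> ('x \<Rightarrow> 'y) set" where
  "biset_hom A X Y = {f. (\<forall>x \<in> points X. f x \<in> points Y) \<and>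
     (\<forall>a \<in> carrier A. \<forall>x \<in> points X. f (lact X a x) = lact Y a (f x)) \<and>
     (\<forall>x \<in> points X. \<forall>a \<in> carrier A. f (ract X x a) = ract Y (f x) a)}"

inductive tensor_step ::
  "('a, 'm) monoid_scheme \<Rightarrow> ('a, 'x) biset \<Rightarrow> ('a, 'y) biset \<Rightarrow> 'x \<times> 'y \<Rightarrow> 'x \<times> 'y \<Rightarrow> bool"
  for A X Y where
  "\<lbrakk>x \<in> points X; a \<in> carrier A; y \<in> points Y\<rbrakk> \<Longrightarrow>
     tensor_step A X Y (ract X x a, y) (x, lact Y a y)"

definition tensor_class ::
  "('a, 'm) monoid_scheme \<Rightarrow> ('a, 'x) biset \<Rightarrow> ('a, 'y) biset \<Rightarrow> 'x \<Rightarrow> 'y \<Rightarrow> ('x \<times> 'y) set" where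
  "tensor_class A X Y x y = {p. equivclp (tensor_step A X Y) (x, y) p}"

text \<open>The map on classes induced by \<open>f\<close>; meaningful when \<open>f\<close> is constant on each class.\<close>

definition tensor_lift :: "('x \<Rightarrow> 'y \<Rightarrow> 'z) \<Rightarrow> ('x \<times> 'y) set \<Rightarrow> 'z" where
  "tensor_lift f C = the_elem ((\<lambda>(x, y). f x y) ` C)"

definition tensor ::
  "('a, 'm) monoid_scheme \<Rightarrow> ('a, 'x) biset \<Rightarrow> ('a, 'y) biset \<Rightarrow> ('a, ('x \<times> 'y) set) biset" where
  "tensor A X Y =
     \<lparr>points = {tensor_class A X Y x y | x y. x \<in> points X \<and> y \<in> points Y},
      lact = (\<lambda>a. tensor_lift (\<lambda>x y. tensor_class A X Y (lact X a x) y)),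
      ract = (\<lambda>C a. tensor_lift (\<lambda>x y. tensor_class A X Y x (ract Y y a)) C)\<rparr>"

definition tensor_map ::
  "('a, 'm) monoid_scheme \<Rightarrow> ('a, 'x) biset \<Rightarrow> ('a, 'y) biset \<Rightarrow>
   ('u \<Rightarrow> 'x) \<Rightarrow> ('v \<Rightarrow> 'y) \<Rightarrow> ('u \<times> 'v) set \<Rightarrow> ('x \<times> 'y) set" where
  "tensor_map A X Y f g = tensor_lift (\<lambda>u v. tensor_class A X Y (f u) (g v))"

definition tensor_assoc ::
  "('a, 'm) monoid_scheme \<Rightarrow> ('a, 'x) biset \<Rightarrow> ('a, 'y) biset \<Rightarrow> ('a, 'z) biset \<Rightarrow>
   (('x \<times> 'y) set \<times> 'z) set \<Rightarrow> ('x \<times> ('y \<times> 'z) set) set" where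
  "tensor_assoc A X Y Z =
     tensor_lift (\<lambda>C z. tensor_lift (\<lambda>x y.
       tensor_class A X (tensor A Y Z) x (tensor_class A Y Z y z)) C)"

definition tensor_lunit :: "('a, 'x) biset \<Rightarrow> ('a \<times> 'x) set \<Rightarrow> 'x" where
  "tensor_lunit X = tensor_lift (lact X)"

definition tensor_runit :: "('a, 'x) biset \<Rightarrow> ('x \<times> 'a) set \<Rightarrow> 'x" where
  "tensor_runit X = tensor_lift (ract X)"

locale biset_comonoid = biset A X
  for A :: "('a, 'm) monoid_scheme" (structure) and X :: "('a, 'x) biset" +
  fixes \<Delta> :: "'x \<Rightarrow> ('x \<times> 'x) set" and \<epsilon> :: "'x \<Rightarrow> 'a"
  assumes comul_hom: "\<Delta> \<in> biset_hom A X (tensor A X X)"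
    and counit_hom: "\<epsilon> \<in> biset_hom A X (regular_biset A)"
    and coassoc: "x \<in> points X \<Longrightarrow>
          tensor_assoc A X X X (tensor_map A (tensor A X X) X \<Delta> id (\<Delta> x))
          = tensor_map A X (tensor A X X) id \<Delta> (\<Delta> x)"
    and counit_left: "x \<in> points X \<Longrightarrow>
          tensor_lunit X (tensor_map A (regular_biset A) X \<epsilon> id (\<Delta> x)) = x"
    and counit_right: "x \<in> points X \<Longrightarrow>
          tensor_runit X (tensor_map A X (regular_biset A) id \<epsilon> (\<Delta> x)) = x"


section \<open>Right bialgebroids\<close>

record ('a, 'g) bialgebroid = "'g monoid" +
  src :: "'a \<Rightarrow> 'g"
  tgt :: "'a \<Rightarrow> 'g"
  comul :: "'g \<Rightarrow> ('g \<times> 'g) set"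
  counit :: "'g \<Rightarrow> 'a"

definition bialgebroid_biset :: "('a, 'g) bialgebroid \<Rightarrow> ('a, 'g) biset" where
  "bialgebroid_biset G =
     \<lparr>points = carrier G, lact = (\<lambda>a g. g \<otimes>\<^bsub>G\<^esub> tgt G a), ract = (\<lambda>g a. g \<otimes>\<^bsub>G\<^esub> src G a)\<rparr>"

abbreviation bialgebroid_tensor ::
  "('a, 'm) monoid_scheme \<Rightarrow> ('a, 'g) bialgebroid \<Rightarrow> 'g \<Rightarrow> 'g \<Rightarrow> ('g \<times> 'g) set" where
  "bialgebroid_tensor A G \<equiv> tensor_class A (bialgebroid_biset G) (bialgebroid_biset G)"

text \<open>
  A statement in Sweedler notation is read for all representatives \<open>(g\<^sub>1, g\<^sub>2)\<close> of the class
  \<open>comul G g\<close>. The factorwise product on \<open>G \<otimes>\<^sub>A G\<close> is not well defined in general, but it is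
  on the classes satisfying \<open>takeuchi\<close>, which include all values of the comultiplication.
\<close>

locale right_bialgebroid =
  A?: monoid A + G?: monoid G
  for A :: "('a, 'm) monoid_scheme" and G :: "('a, 'g) bialgebroid" +
  assumes src_hom: "src G \<in> monoid_hom A G"
    and tgt_hom: "tgt G \<in> monoid_hom (op_monoid A) G"
    and src_tgt_commute: "\<lbrakk>a \<in> carrier A; b \<in> carrier A\<rbrakk> \<Longrightarrow>
          src G a \<otimes>\<^bsub>G\<^esub> tgt G b = tgt G b \<otimes>\<^bsub>G\<^esub> src G a"
    and comonoid: "biset_comonoid A (bialgebroid_biset G) (comul G) (counit G)"
    and takeuchi: "\<lbrakk>a \<in> carrier A; g \<in> carrier G; (g\<^sub>1, g\<^sub>2) \<in> comul G g\<rbrakk> \<Longrightarrow>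
          bialgebroid_tensor A G (src G a \<otimes>\<^bsub>G\<^esub> g\<^sub>1) g\<^sub>2
          = bialgebroid_tensor A G g\<^sub>1 (tgt G a \<otimes>\<^bsub>G\<^esub> g\<^sub>2)"
    and comul_mult: "\<lbrakk>g \<in> carrier G; h \<in> carrier G;
            (g\<^sub>1, g\<^sub>2) \<in> comul G g; (h\<^sub>1, h\<^sub>2) \<in> comul G h\<rbrakk> \<Longrightarrow>
          comul G (g \<otimes>\<^bsub>G\<^esub> h) = bialgebroid_tensor A G (g\<^sub>1 \<otimes>\<^bsub>G\<^esub> h\<^sub>1) (g\<^sub>2 \<otimes>\<^bsub>G\<^esub> h\<^sub>2)"
    and comul_one: "comul G \<one>\<^bsub>G\<^esub> = bialgebroid_tensor A G \<one>\<^bsub>G\<^esub> \<one>\<^bsub>G\<^esub>"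
    and counit_one: "counit G \<one>\<^bsub>G\<^esub> = \<one>\<^bsub>A\<^esub>"
    and counit_src: "\<lbrakk>g \<in> carrier G; h \<in> carrier G\<rbrakk> \<Longrightarrow>
          counit G (src G (counit G g) \<otimes>\<^bsub>G\<^esub> h) = counit G (g \<otimes>\<^bsub>G\<^esub> h)"
    and counit_tgt: "\<lbrakk>g \<in> carrier G; h \<in> carrier G\<rbrakk> \<Longrightarrow>
          counit G (g \<otimes>\<^bsub>G\<^esub> h) = counit G (tgt G (counit G g) \<otimes>\<^bsub>G\<^esub> h)"

definition source_regular :: "('a, 'm) monoid_scheme \<Rightarrow> ('a, 'g) bialgebroid \<Rightarrow> bool" where
  "source_regular A G \<longleftrightarrow>
     (\<exists>\<theta>. bij_betw \<theta> (carrier A) (carrier G) \<and>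
          (\<forall>a \<in> carrier A. \<forall>b \<in> carrier A. \<theta> (a \<otimes>\<^bsub>A\<^esub> b) = \<theta> a \<otimes>\<^bsub>G\<^esub> src G b))"

definition bialgebroid_isomorphism ::
  "('a, 'm) monoid_scheme \<Rightarrow> ('a, 'g) bialgebroid \<Rightarrow>
   ('b, 'n) monoid_scheme \<Rightarrow> ('b, 'h) bialgebroid \<Rightarrow> ('g \<Rightarrow> 'h) \<Rightarrow> ('a \<Rightarrow> 'b) \<Rightarrow> bool" where
  "bialgebroid_isomorphism A G A' G' \<phi> \<phi>\<^sub>0 \<longleftrightarrow>
     \<phi> \<in> iso G G' \<and> \<phi>\<^sub>0 \<in> iso A A' \<and>
     (\<forall>a \<in> carrier A. \<phi> (src G a) = src G' (\<phi>\<^sub>0 a)) \<and>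
     (\<forall>a \<in> carrier A. \<phi> (tgt G a) = tgt G' (\<phi>\<^sub>0 a)) \<and>
     (\<forall>g \<in> carrier G. counit G' (\<phi> g) = \<phi>\<^sub>0 (counit G g)) \<and>
     (\<forall>g \<in> carrier G. \<forall>(g\<^sub>1, g\<^sub>2) \<in> comul G g.
        comul G' (\<phi> g) = bialgebroid_tensor A' G' (\<phi> g\<^sub>1) (\<phi> g\<^sub>2))"

definition source_regular_bialgebroids ::
  "('a, 'm) monoid_scheme \<Rightarrow> ('a, 'g) bialgebroid set" where
  "source_regular_bialgebroids A = {G. right_bialgebroid A G \<and> source_regular A G}"

definition bialgebroid_iso_rel ::
  "('a, 'm) monoid_scheme \<Rightarrow> (('a, 'g) bialgebroid \<times> ('a, 'g) bialgebroid) set" where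
  "bialgebroid_iso_rel A =
     {(G, G'). G \<in> source_regular_bialgebroids A \<and> G' \<in> source_regular_bialgebroids A \<and>
        (\<exists>\<phi> \<phi>\<^sub>0. bialgebroid_isomorphism A G A G' \<phi> \<phi>\<^sub>0)}"

definition bialgebroid_iso_classes ::
  "('a, 'm) monoid_scheme \<Rightarrow> ('a, 'g) bialgebroid set set" where
  "bialgebroid_iso_classes A = source_regular_bialgebroids A // bialgebroid_iso_rel A"

text \<open>
  The underlying set of a bialgebroid over \<open>A\<close> is a subset of an ambient type \<open>'g\<close>. A
  source-regular one is in bijection with the carrier of \<open>A\<close>, so every type into which that
  carrier embeds (such as \<open>'a\<close> itself) contains representatives of all isomorphism classes.
\<close>

end

theory Submission
  imports Defs
begin

text \<open>
  Let \<open>\<theta>: A \<rightarrow> G\<close> be an isomorphism of right \<open>A\<close>-sets onto a source-regular bialgebroid. Left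
  multiplication by \<open>s\<^sup>G a\<close> and right multiplication by \<open>t\<^sup>G a\<close> commute with the right \<open>A\<close>-action, so
  they send \<open>\<theta> b\<close> to \<open>\<theta> (T a b)\<close> and \<open>\<theta> (Q a b)\<close> for commuting endomorphisms \<open>T\<close>, \<open>Q\<close> of \<open>A\<close>. With
  \<open>\<theta> 1 \<theta> 1 = \<theta> \<mu>\<close>, \<open>1 = \<theta> \<eta>\<close>, \<open>\<Delta> (\<theta> 1) = \<theta> 1 \<otimes> \<theta> \<delta>\<close> and \<open>\<epsilon>\<^sup>G (\<theta> 1) = \<epsilon>\<close> the whole structure of
  \<open>G\<close> is determined by \<open>T\<close>, \<open>Q\<close>, \<open>\<mu>\<close>, \<open>\<eta>\<close>, \<open>\<delta>\<close>, \<open>\<epsilon>\<close>, and the bialgebroid axioms become equations in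
  \<open>A\<close> that are equivalent to those of a skew monoidal monoid with \<open>\<gamma> = \<mu> \<delta>\<close>. A bialgebroid
  isomorphism over \<open>\<phi>\<close> has the form \<open>\<theta> a \<mapsto> \<theta>' (u \<phi>(a))\<close> with \<open>u\<close> invertible, and it corresponds to
  the isomorphism \<open>(\<phi>, u\<^sup>-\<^sup>1, 1)\<close> of skew monoidal monoids; conjugation by \<open>\<phi>\<^sub>0\<close> reduces a general
  isomorphism to one of this form.
\<close>


section \<open>Equations for the presentation with \<open>\<mu>\<close> and \<open>\<delta>\<close>\<close>

lemma monoid_homD:
  assumes "h \<in> monoid_hom A B"
  shows "\<And>a. a \<in> carrier A \<Longrightarrow> h a \<in> carrier B"
    and "\<And>a b. \<lbrakk>a \<in> carrier A; b \<in> carrier A\<rbrakk> \<Longrightarrow> h (a \<otimes>\<^bsub>A\<^esub> b) = h a \<otimes>\<^bsub>B\<^esub> h b"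
    and "h \<one>\<^bsub>A\<^esub> = \<one>\<^bsub>B\<^esub>"
  using assms by (auto simp: monoid_hom_def hom_def)

lemma monoid_homI:
  assumes "\<And>a. a \<in> carrier A \<Longrightarrow> h a \<in> carrier B"
    and "\<And>a b. \<lbrakk>a \<in> carrier A; b \<in> carrier A\<rbrakk> \<Longrightarrow> h (a \<otimes>\<^bsub>A\<^esub> b) = h a \<otimes>\<^bsub>B\<^esub> h b"
    and "h \<one>\<^bsub>A\<^esub> = \<one>\<^bsub>B\<^esub>"
  shows "h \<in> monoid_hom A B"
  using assms by (auto simp: monoid_hom_def hom_def)

text \<open>Once \<open>m_assoc\<close> has bracketed all products to the right, the left side of an
  equation between short products no longer occurs as a subterm when another factor follows. This
  form makes such equations applicable there.\<close>

lemma (in monoid) rewrite_prefix2: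
  assumes "x \<otimes> y = z" "x \<in> carrier G" "y \<in> carrier G" "w \<in> carrier G"
  shows "x \<otimes> (y \<otimes> w) = z \<otimes> w"
  using assms by (simp add: m_assoc [symmetric])

text \<open>These are the bialgebroid axioms in coordinates: \<open>mu_mu\<close> with
  \<open>mu_TT\<close> is associativity, \<open>mu_eta\<close> and \<open>mu_T_eta\<close> are the
  unit laws, \<open>delta_delta\<close>, \<open>Q_eps_delta\<close> and \<open>eps_delta\<close> the
  comonoid laws, \<open>QT_delta\<close> is the Takeuchi condition, \<open>delta_mu\<close> and
  \<open>delta_eta\<close> make the comultiplication respect product and unit, \<open>eps_mu\<close>
  and \<open>eps_eta\<close> do so for the counit.\<close>

locale mu_delta_monoid = monoid A for A :: "('a, 'm) monoid_scheme" (structure) +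
  fixes T Q :: "'a \<Rightarrow> 'a" and \<mu> \<eta> \<delta> \<epsilon> :: 'a
  assumes T_hom: "T \<in> monoid_hom A A"
    and Q_hom: "Q \<in> monoid_hom A A"
    and mu_closed [simp]: "\<mu> \<in> carrier A"
    and eta_closed [simp]: "\<eta> \<in> carrier A"
    and delta_closed [simp]: "\<delta> \<in> carrier A"
    and eps_closed [simp]: "\<epsilon> \<in> carrier A"
    and T_Q: "\<lbrakk>a \<in> carrier A; b \<in> carrier A\<rbrakk> \<Longrightarrow> T a \<otimes> Q b = Q b \<otimes> T a"
    and eta_T: "a \<in> carrier A \<Longrightarrow> \<eta> \<otimes> a = T a \<otimes> \<eta>"
    and eps_Q: "a \<in> carrier A \<Longrightarrow> a \<otimes> \<epsilon> = \<epsilon> \<otimes> Q a"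
    and mu_TT: "a \<in> carrier A \<Longrightarrow> \<mu> \<otimes> T (T a) = T a \<otimes> \<mu>"
    and mu_Q: "a \<in> carrier A \<Longrightarrow> \<mu> \<otimes> Q a = Q a \<otimes> \<mu>"
    and delta_T: "a \<in> carrier A \<Longrightarrow> \<delta> \<otimes> T a = T a \<otimes> \<delta>"
    and delta_Q: "a \<in> carrier A \<Longrightarrow> \<delta> \<otimes> Q a = Q (Q a) \<otimes> \<delta>"
    and mu_mu: "\<mu> \<otimes> T \<mu> = \<mu> \<otimes> \<mu>"
    and mu_eta: "\<mu> \<otimes> \<eta> = \<one>"
    and mu_T_eta: "\<mu> \<otimes> T \<eta> = \<one>"
    and delta_delta: "Q \<delta> \<otimes> \<delta> = \<delta> \<otimes> \<delta>"
    and Q_eps_delta: "Q \<epsilon> \<otimes> \<delta> = \<one>"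
    and eps_delta: "\<epsilon> \<otimes> \<delta> = \<one>"
    and QT_delta: "a \<in> carrier A \<Longrightarrow> Q (T a) \<otimes> \<delta> = \<mu> \<otimes> T (Q a) \<otimes> T \<eta> \<otimes> \<delta>"
    and delta_mu: "\<delta> \<otimes> \<mu> = Q \<mu> \<otimes> \<mu> \<otimes> T \<delta> \<otimes> \<delta>"
    and delta_eta: "\<delta> \<otimes> \<eta> = Q \<eta> \<otimes> \<eta>"
    and eps_mu: "\<epsilon> \<otimes> \<mu> = \<epsilon> \<otimes> T \<epsilon>"
    and eps_eta: "\<epsilon> \<otimes> \<eta> = \<one>"
begin

lemmas T_closed [simp] = monoid_homD(1) [OF T_hom]
lemmas T_mult = monoid_homD(2) [OF T_hom]
lemmas T_one [simp] = monoid_homD(3) [OF T_hom]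
lemmas Q_closed [simp] = monoid_homD(1) [OF Q_hom]
lemmas Q_mult = monoid_homD(2) [OF Q_hom]
lemmas Q_one [simp] = monoid_homD(3) [OF Q_hom]

definition to_smm :: "'a smm" where
  "to_smm = \<lparr>smm_T = T, smm_Q = Q, smm_gamma = \<mu> \<otimes> \<delta>, smm_eta = \<eta>, smm_eps = \<epsilon>\<rparr>"

text \<open>Naturality of \<gamma> = \<mu>\<delta> combines the naturality of the two factors,
  except for arguments \<open>T (Q a)\<close>, where \<open>QT_delta\<close> is used. The pentagon
  is \<open>delta_mu\<close> multiplied by \<mu> on the left and \<delta> on the right.\<close>

lemma skew_monoidal_monoid_to_smm: "skew_monoidal_monoid A to_smm"
proof -
  note rw = rewrite_prefix2
  have g_TT: "\<mu> \<otimes> \<delta> \<otimes> T (T a) = T a \<otimes> (\<mu> \<otimes> \<delta>)" if "a \<in> carrier A" for a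
    using that by (simp add: m_assoc delta_T rw [OF mu_TT])
  have g_TQ: "\<mu> \<otimes> \<delta> \<otimes> T (Q a) = Q (T a) \<otimes> (\<mu> \<otimes> \<delta>)" if a: "a \<in> carrier A" for a
  proof -
    have "Q (T a) \<otimes> (\<mu> \<otimes> \<delta>) = \<mu> \<otimes> (Q (T a) \<otimes> \<delta>)"
      using a by (simp add: m_assoc rw [OF mu_Q])
    \<comment> \<open>\<open>QT_delta\<close> introduces a second \<mu>, which \<open>mu_mu\<close>
      puts under \<open>T\<close>. The bracket is then a single value of \<open>T\<close>, whose
      argument collapses to \<open>Q a\<close>.\<close>
    also have "\<dots> = \<mu> \<otimes> (T \<mu> \<otimes> T (Q a) \<otimes> T \<eta>) \<otimes> \<delta>"
      using a by (simp add: QT_delta m_assoc rw [OF mu_mu])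
    also have "T \<mu> \<otimes> T (Q a) \<otimes> T \<eta> = T (\<mu> \<otimes> Q a \<otimes> \<eta>)"
      using a by (simp add: T_mult)
    also have "\<mu> \<otimes> Q a \<otimes> \<eta> = Q a"
      using a by (simp add: mu_Q m_assoc mu_eta)
    finally show ?thesis using a by (simp add: m_assoc delta_T)
  qed
  have g_Q: "\<mu> \<otimes> \<delta> \<otimes> Q a = Q (Q a) \<otimes> (\<mu> \<otimes> \<delta>)" if "a \<in> carrier A" for a
    using that by (simp add: m_assoc delta_Q rw [OF mu_Q])
  have "Q (\<mu> \<otimes> \<delta>) \<otimes> (\<mu> \<otimes> \<delta>) \<otimes> T (\<mu> \<otimes> \<delta>) = Q \<mu> \<otimes> \<mu> \<otimes> (Q \<delta> \<otimes> \<delta>) \<otimes> T (\<mu> \<otimes> \<delta>)"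
    by (simp add: m_assoc Q_mult rw [OF mu_Q])
  also have "\<dots> = Q \<mu> \<otimes> \<mu> \<otimes> T (\<mu> \<otimes> \<delta>) \<otimes> \<delta> \<otimes> \<delta>"
    by (simp add: delta_delta m_assoc delta_T rw [OF delta_T])
  also have "\<dots> = Q \<mu> \<otimes> \<mu> \<otimes> \<mu> \<otimes> T \<delta> \<otimes> \<delta> \<otimes> \<delta>"
    by (simp add: T_mult m_assoc rw [OF mu_mu])
  \<comment> \<open>Moving one \<mu> to the front past \<open>Q \<mu>\<close> isolates the right
    side of \<open>delta_mu\<close>.\<close>
  also have "\<dots> = \<mu> \<otimes> (Q \<mu> \<otimes> \<mu> \<otimes> T \<delta> \<otimes> \<delta>) \<otimes> \<delta>"
    by (simp add: m_assoc rw [OF mu_Q])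
  also have "\<dots> = \<mu> \<otimes> \<delta> \<otimes> (\<mu> \<otimes> \<delta>)"
    by (simp only: delta_mu [symmetric]) (simp add: m_assoc)
  finally have pent: "Q (\<mu> \<otimes> \<delta>) \<otimes> (\<mu> \<otimes> \<delta>) \<otimes> T (\<mu> \<otimes> \<delta>) = \<mu> \<otimes> \<delta> \<otimes> (\<mu> \<otimes> \<delta>)" .
  have g_eta: "\<mu> \<otimes> \<delta> \<otimes> \<eta> = Q \<eta>"
    by (simp add: m_assoc delta_eta rw [OF mu_Q] mu_eta)
  have e_g: "\<epsilon> \<otimes> (\<mu> \<otimes> \<delta>) = T \<epsilon>"
    by (simp add: rw [OF eps_mu] m_assoc delta_T [symmetric] rw [OF eps_delta])
  have tri: "Q \<epsilon> \<otimes> (\<mu> \<otimes> \<delta>) \<otimes> T \<eta> = \<one>"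
    by (simp add: m_assoc delta_T rw [OF mu_Q [symmetric]] rw [OF T_Q [symmetric]]
        rw [OF mu_T_eta] mu_T_eta Q_eps_delta)
  show ?thesis
    by unfold_locales
      (simp_all add: to_smm_def T_hom Q_hom T_Q eta_T eps_Q eps_eta g_TT g_TQ g_Q pent g_eta e_g tri)
qed

text \<open>Together with \<open>delta_from_gamma\<close> this recovers both factors from their
  product \<gamma>, so passing to \<gamma> and back loses nothing.\<close>

lemma mu_from_gamma: "Q \<epsilon> \<otimes> (\<mu> \<otimes> \<delta>) = \<mu>"
  by (simp add: rewrite_prefix2 [OF mu_Q [symmetric]] m_assoc Q_eps_delta)

lemma delta_from_gamma: "\<mu> \<otimes> \<delta> \<otimes> T \<eta> = \<delta>"
  by (simp add: m_assoc delta_T rewrite_prefix2 [OF mu_T_eta])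

lemma md_of_to_smm:
  "md_of_smm A to_smm = \<lparr>md_T = T, md_Q = Q, md_mu = \<mu>, md_eta = \<eta>, md_delta = \<delta>, md_eps = \<epsilon>\<rparr>"
  by (simp add: md_of_smm_def to_smm_def mu_from_gamma delta_from_gamma)

end

abbreviation mu_delta_smm :: "('a, 'm) monoid_scheme \<Rightarrow> 'a smm_md \<Rightarrow> bool" where
  "mu_delta_smm A M \<equiv>
     mu_delta_monoid A (md_T M) (md_Q M) (md_mu M) (md_eta M) (md_delta M) (md_eps M)"

text \<open>The pentagon yields \<open>mu_mu\<close>, \<open>delta_delta\<close> and
  \<open>delta_mu\<close> after multiplication by images of \<epsilon> on the left, of \<eta> on the
  right, or both.\<close>

lemma (in skew_monoidal_monoid) mu_delta_md_of_smm: "mu_delta_smm A (md_of_smm A S)"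
proof -
  let ?T = "smm_T S" and ?Q = "smm_Q S" and ?g = "smm_gamma S"
    and ?n = "smm_eta S" and ?e = "smm_eps S"
  define m d where md: "m = ?Q ?e \<otimes> ?g" "d = ?g \<otimes> ?T ?n"
  note hom = monoid_homD [OF T_hom] monoid_homD [OF Q_hom]
  note cl = gamma_closed eta_closed eps_closed hom(1,4)
  note rw = rewrite_prefix2
  have mc: "m \<in> carrier A" and dc: "d \<in> carrier A" by (simp_all add: md cl)
  have g: "m \<otimes> d = ?g"
    using arg_cong [OF smm_of_md_of_smm, of smm_gamma] by (simp add: smm_of_md_def md_of_smm_def md)
  have m_TT: "m \<otimes> ?T (?T a) = ?T a \<otimes> m" if "a \<in> carrier A" for a
    using that by (simp add: md m_assoc cl gamma_TT rw [OF T_Q_commute])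
  have m_Q: "m \<otimes> ?Q a = ?Q a \<otimes> m" if a: "a \<in> carrier A" for a
  proof -
    have "m \<otimes> ?Q a = ?Q (?e \<otimes> ?Q a) \<otimes> ?g"
      using a by (simp add: md m_assoc cl gamma_Q hom)
    then show ?thesis using a by (simp add: eps_nat [symmetric] hom m_assoc cl md)
  qed
  have d_T: "d \<otimes> ?T a = ?T a \<otimes> d" if a: "a \<in> carrier A" for a
  proof -
    have "d \<otimes> ?T a = ?g \<otimes> ?T (?n \<otimes> a)"
      using a by (simp add: md m_assoc cl hom)
    then show ?thesis using a by (simp add: eta_nat hom rw [OF gamma_TT] m_assoc cl md)
  qed
  have d_Q: "d \<otimes> ?Q a = ?Q (?Q a) \<otimes> d" if "a \<in> carrier A" for a
    using that by (simp add: md m_assoc cl T_Q_commute rw [OF gamma_Q])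
  have "m \<otimes> ?T m = ?Q (?e \<otimes> ?T ?e) \<otimes> ?g \<otimes> ?T ?g"
    by (simp add: md hom cl m_assoc rw [OF gamma_TQ])
  \<comment> \<open>Here T(\<epsilon>) = \<epsilon>\<gamma> and \<epsilon>\<epsilon> =
    \<epsilon>Q(\<epsilon>). Under \<open>?Q\<close> this produces the factor \<open>?Q ?g\<close>
    that the pentagon requires.\<close>
  also have "?e \<otimes> ?T ?e = ?e \<otimes> ?Q ?e \<otimes> ?g"
    by (simp add: eps_gamma [symmetric] eps_nat [symmetric] m_assoc cl)
  also have "?Q (?e \<otimes> ?Q ?e \<otimes> ?g) \<otimes> ?g \<otimes> ?T ?g = ?Q ?e \<otimes> ?Q (?Q ?e) \<otimes> (?Q ?g \<otimes> ?g \<otimes> ?T ?g)"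
    by (simp add: hom cl m_assoc)
  also have "\<dots> = m \<otimes> m"
    by (simp add: pentagon md cl m_assoc rw [OF gamma_Q])
  finally have mm: "m \<otimes> ?T m = m \<otimes> m" .
  have m_n: "m \<otimes> ?n = \<one>"
    by (simp add: md m_assoc cl gamma_eta hom(5) [symmetric] eps_eta hom(6))
  have "?Q d \<otimes> d = ?Q ?g \<otimes> ?g \<otimes> ?T (?Q ?n \<otimes> ?n)"
    by (simp add: md hom cl m_assoc rw [OF gamma_TQ])
  \<comment> \<open>Dually, Q(\<eta>) = \<gamma>\<eta> and \<eta>\<eta> = T(\<eta>)\<eta> supply the
    factor \<open>?T ?g\<close> of the pentagon.\<close>
  also have "?Q ?n \<otimes> ?n = ?g \<otimes> ?T ?n \<otimes> ?n"
    by (simp add: gamma_eta [symmetric] eta_nat [symmetric] m_assoc cl)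
  also have "?Q ?g \<otimes> ?g \<otimes> ?T (?g \<otimes> ?T ?n \<otimes> ?n) = ?Q ?g \<otimes> ?g \<otimes> ?T ?g \<otimes> ?T (?T ?n) \<otimes> ?T ?n"
    by (simp add: hom cl m_assoc)
  also have "\<dots> = d \<otimes> d"
    by (simp add: pentagon md cl m_assoc rw [OF gamma_TT])
  finally have dd: "?Q d \<otimes> d = d \<otimes> d" .
  have e_d: "?e \<otimes> d = \<one>"
    by (simp add: md rw [OF eps_gamma] cl hom(2) [symmetric] eps_eta hom(3))
  have d_n: "d \<otimes> ?n = ?Q ?n \<otimes> ?n"
    by (simp add: md m_assoc cl eta_nat [symmetric] rw [OF gamma_eta])
  \<comment> \<open>The pentagon multiplied by \<open>?Q ?e\<close> on the left. It lets
    \<open>m\<close> pass through \<open>?g\<close> and land under \<open>?T\<close>, as the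
    Takeuchi equation below needs.\<close>
  have m_g: "m \<otimes> ?g = ?g \<otimes> ?T m"
  proof -
    have "m \<otimes> ?g = ?Q ?e \<otimes> (?Q ?g \<otimes> ?g \<otimes> ?T ?g)"
      by (simp add: pentagon md cl m_assoc)
    also have "\<dots> = ?Q (?e \<otimes> ?g) \<otimes> ?g \<otimes> ?T ?g" by (simp add: hom cl m_assoc)
    finally show ?thesis by (simp add: eps_gamma md hom cl m_assoc rw [OF gamma_TQ])
  qed
  have QT_d: "?Q (?T a) \<otimes> d = m \<otimes> ?T (?Q a) \<otimes> ?T ?n \<otimes> d" if a: "a \<in> carrier A" for a
  proof -
    have "m \<otimes> ?T (?Q a) \<otimes> ?T ?n \<otimes> d = m \<otimes> (?T (?Q a \<otimes> ?n) \<otimes> ?g) \<otimes> ?T ?n"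
      using a by (simp add: md hom cl m_assoc)
    also have "\<dots> = m \<otimes> ?g \<otimes> ?T (?T (?Q a \<otimes> ?n)) \<otimes> ?T ?n"
      using a by (simp add: gamma_TT [symmetric] cl m_assoc mc)
    also have "\<dots> = ?g \<otimes> ?T (m \<otimes> (?T (?Q a \<otimes> ?n) \<otimes> ?n))"
      using a by (simp add: m_g hom cl m_assoc mc)
    also have "m \<otimes> (?T (?Q a \<otimes> ?n) \<otimes> ?n) = ?Q a \<otimes> ?n"
      using a by (simp add: eta_nat [symmetric] cl rw [OF m_n] mc)
    finally show ?thesis using a by (simp add: md hom cl m_assoc rw [OF gamma_TQ])
  qed
  \<comment> \<open>Once \<open>m \<otimes> d\<close> is contracted to \<open>?g\<close>, this is
    the pentagon between \<open>?Q (?Q ?e)\<close> and \<open>?T (?T ?n)\<close>.\<close>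
  have "?Q m \<otimes> m \<otimes> ?T d \<otimes> d = ?Q m \<otimes> (m \<otimes> d) \<otimes> ?T d"
    by (simp add: mc dc cl m_assoc d_T)
  also have "\<dots> = ?Q (?Q ?e) \<otimes> (?Q ?g \<otimes> ?g \<otimes> ?T ?g) \<otimes> ?T (?T ?n)"
    by (simp only: g) (simp add: md hom cl m_assoc)
  also have "\<dots> = (?Q (?Q ?e) \<otimes> ?g) \<otimes> (?g \<otimes> ?T (?T ?n))"
    by (simp add: pentagon cl m_assoc)
  also have "\<dots> = ?g \<otimes> (?Q ?e \<otimes> ?T ?n) \<otimes> ?g"
    by (simp add: gamma_TT gamma_Q [symmetric] cl m_assoc)
  also have "\<dots> = d \<otimes> m"
    by (simp add: md T_Q_commute [symmetric] cl m_assoc)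
  finally have dm: "d \<otimes> m = ?Q m \<otimes> m \<otimes> ?T d \<otimes> d" by simp
  have e_m: "?e \<otimes> m = ?e \<otimes> ?T ?e"
    by (simp add: md rw [OF eps_nat [symmetric]] m_assoc cl eps_gamma)
  have tri: "m \<otimes> ?T ?n = \<one>" "?Q ?e \<otimes> d = \<one>"
    using triangle by (simp_all add: md m_assoc cl)
  have "mu_delta_monoid A ?T ?Q m ?n d ?e"
    by unfold_locales
      (fact T_hom Q_hom mc dc cl T_Q_commute eta_nat eps_nat m_TT m_Q d_T d_Q mm m_n tri dd e_d QT_d
        dm d_n e_m eps_eta)+
  then show ?thesis by (simp add: md_of_smm_def md)
qed

text \<open>Replaces the image that defines \<open>smm_mds\<close> by equations; conversely, a
  preimage is obtained by setting \<gamma> = \<mu>\<delta>.\<close>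

lemma smm_mds_iff:
  "M \<in> smm_mds A \<longleftrightarrow> mu_delta_smm A M"
proof
  assume "M \<in> smm_mds A"
  then show "mu_delta_smm A M"
    by (auto simp: smm_mds_def intro: skew_monoidal_monoid.mu_delta_md_of_smm)
next
  assume M: "mu_delta_smm A M"
  note mu_delta_monoid.md_of_to_smm [OF M, simp]
  show "M \<in> smm_mds A"
    unfolding smm_mds_def
    by (rule image_eqI [where x = "mu_delta_monoid.to_smm A (md_T M) (md_Q M) (md_mu M) (md_eta M) (md_delta M) (md_eps M)"])
      (use mu_delta_monoid.skew_monoidal_monoid_to_smm [OF M] in simp_all)
qed

section \<open>Bisets that are regular as right sets\<close>

text \<open>Maps commuting with the regular right action are left multiplications. So a left action
  on a biset that is free of rank 1 on the right amounts, in the coordinate \<theta>, to an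
  endomorphism \<open>Q\<close> of the monoid.\<close>

locale framed_biset = monoid A for A :: "('a, 'm) monoid_scheme" (structure) +
  fixes X :: "('a, 'x) biset" and \<theta> :: "'a \<Rightarrow> 'x" and Q :: "'a \<Rightarrow> 'a"
  assumes Q_hom: "Q \<in> monoid_hom A A"
    and frame: "bij_betw \<theta> (carrier A) (points X)"
    and lact_frame: "\<lbrakk>a \<in> carrier A; b \<in> carrier A\<rbrakk> \<Longrightarrow> lact X a (\<theta> b) = \<theta> (Q a \<otimes> b)"
    and ract_frame: "\<lbrakk>a \<in> carrier A; b \<in> carrier A\<rbrakk> \<Longrightarrow> ract X (\<theta> a) b = \<theta> (a \<otimes> b)"
begin

lemmas Q_closed [simp] = monoid_homD(1) [OF Q_hom]
lemmas Q_mult = monoid_homD(2) [OF Q_hom]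
lemmas Q_one [simp] = monoid_homD(3) [OF Q_hom]

lemma frame_closed [simp]: "a \<in> carrier A \<Longrightarrow> \<theta> a \<in> points X"
  using frame by (rule bij_betw_apply)

lemma frame_eq_iff [simp]: "\<lbrakk>a \<in> carrier A; b \<in> carrier A\<rbrakk> \<Longrightarrow> \<theta> a = \<theta> b \<longleftrightarrow> a = b"
  using frame by (auto simp: bij_betw_def dest: inj_onD)

lemma frame_cases:
  assumes "x \<in> points X"
  obtains a where "a \<in> carrier A" "x = \<theta> a"
  using assms frame by (auto simp: bij_betw_def)

sublocale biset A X
proof
  fix a x assume "a \<in> carrier A" "x \<in> points X"
  then show "lact X a x \<in> points X" "ract X x a \<in> points X"
    by (auto elim!: frame_cases simp: lact_frame ract_frame)
next
  fix x assume "x \<in> points X"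
  then show "lact X \<one> x = x" "ract X x \<one> = x"
    by (auto elim!: frame_cases simp: lact_frame ract_frame)
next
  fix a b x assume "a \<in> carrier A" "b \<in> carrier A" "x \<in> points X"
  then show "lact X (a \<otimes> b) x = lact X a (lact X b x)"
    by (auto elim!: frame_cases simp: lact_frame m_assoc Q_mult)
next
  fix x a b assume "x \<in> points X" "a \<in> carrier A" "b \<in> carrier A"
  then show "ract X x (a \<otimes> b) = ract X (ract X x a) b"
    by (auto elim!: frame_cases simp: ract_frame m_assoc)
next
  fix a x b assume "a \<in> carrier A" "x \<in> points X" "b \<in> carrier A"
  then show "ract X (lact X a x) b = lact X a (ract X x b)"
    by (auto elim!: frame_cases simp: ract_frame lact_frame m_assoc)
qed

end

lemma framed_regular_biset:
  fixes A (structure)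
  assumes "monoid A"
  shows "framed_biset A (regular_biset A) id id"
proof -
  interpret monoid A by fact
  show ?thesis by unfold_locales (auto simp: regular_biset_def monoid_hom_def hom_def m_assoc)
qed

text \<open>Since \<open>\<theta> x \<otimes> \<psi> y = \<theta> 1 \<otimes> \<psi> (R x y)\<close>, framed bisets are closed under the tensor product,
  and \<open>R x y\<close> is a complete invariant of the class of \<open>(\<theta> x, \<psi> y)\<close>.\<close>

locale framed_biset_pair = X: framed_biset A X \<theta> Q + Y: framed_biset A Y \<psi> R
  for A :: "('a, 'm) monoid_scheme" (structure)
    and X :: "('a, 'x) biset" and \<theta> Q and Y :: "('a, 'y) biset" and \<psi> R
begin

definition tensor_frame :: "'a \<Rightarrow> ('x \<times> 'y) set" where
  "tensor_frame a = tensor_class A X Y (\<theta> \<one>) (\<psi> a)"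

lemma tensor_step_frame: "\<lbrakk>x \<in> carrier A; a \<in> carrier A; y \<in> carrier A\<rbrakk> \<Longrightarrow>
    tensor_step A X Y (\<theta> (x \<otimes> a), \<psi> y) (\<theta> x, \<psi> (R a \<otimes> y))"
  using tensor_step.intros [of "\<theta> x" X a A "\<psi> y" Y]
  by (simp add: X.ract_frame Y.lact_frame)

text \<open>Moving \<open>a\<close> across changes nothing because \<open>R (x \<otimes> a)
  \<otimes> y = R x \<otimes> (R a \<otimes> y)\<close>.\<close>

lemma tensor_step_invariant:
  assumes "tensor_step A X Y p q"
  obtains x y x' y' where "p = (\<theta> x, \<psi> y)" "q = (\<theta> x', \<psi> y')"
    "x \<in> carrier A" "y \<in> carrier A" "x' \<in> carrier A" "y' \<in> carrier A" "R x \<otimes> y = R x' \<otimes> y'"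
  using assms
proof cases
  case (1 x a y)
  obtain b c where "b \<in> carrier A" "c \<in> carrier A" "x = \<theta> b" "y = \<psi> c"
    using 1 by (metis X.frame_cases Y.frame_cases)
  then show ?thesis
    using 1 by (intro that [of "b \<otimes> a" c b "R a \<otimes> c"])
      (auto simp: X.ract_frame Y.lact_frame Y.Q_mult X.m_assoc)
qed

text \<open>Invariance along zigzags of generating steps gives one inclusion. For the other, one
  step brings any pair to first coordinate \<open>\<one>\<close>, and its second coordinate is then
  the invariant.\<close>

lemma tensor_class_frame:
  assumes "x \<in> carrier A" "y \<in> carrier A"
  shows "tensor_class A X Y (\<theta> x) (\<psi> y)
    = {(\<theta> x', \<psi> y') | x' y'. x' \<in> carrier A \<and> y' \<in> carrier A \<and> R x' \<otimes> y' = R x \<otimes> y}"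
    (is "_ = ?C")
proof (intro equalityI subsetI)
  fix p assume "p \<in> tensor_class A X Y (\<theta> x) (\<psi> y)"
  then have "equivclp (tensor_step A X Y) (\<theta> x, \<psi> y) p" by (simp add: tensor_class_def)
  then show "p \<in> ?C"
  proof (induction rule: equivclp_induct)
    case base
    show ?case using assms by auto
  next
    case (step p q)
    then have "tensor_step A X Y p q \<or> tensor_step A X Y q p" by auto
    then obtain x' y' where "q = (\<theta> x', \<psi> y')" "x' \<in> carrier A" "y' \<in> carrier A" "R x' \<otimes> y' = R x \<otimes> y"
      using step.IH by (auto elim!: tensor_step_invariant)
    then show ?case by blast
  qed
next
  have to_one: "equivclp (tensor_step A X Y) (\<theta> a, \<psi> b) (\<theta> \<one>, \<psi> (R a \<otimes> b))"
    if "a \<in> carrier A" "b \<in> carrier A" for a b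
    using tensor_step_frame [of \<one> a b] that by (auto intro: r_into_equivclp)
  fix p assume "p \<in> ?C"
  then obtain x' y' where *: "p = (\<theta> x', \<psi> y')" "x' \<in> carrier A" "y' \<in> carrier A"
    "R x' \<otimes> y' = R x \<otimes> y" by auto
  have "equivclp (tensor_step A X Y) (\<theta> x, \<psi> y) p"
    using to_one [OF assms] to_one [OF *(2,3)] * by (metis equivclp_sym equivclp_trans)
  then show "p \<in> tensor_class A X Y (\<theta> x) (\<psi> y)" by (simp add: tensor_class_def)
qed

lemma tensor_class_eq_frame:
  "\<lbrakk>x \<in> carrier A; y \<in> carrier A\<rbrakk> \<Longrightarrow> tensor_class A X Y (\<theta> x) (\<psi> y) = tensor_frame (R x \<otimes> y)"
  by (simp add: tensor_frame_def tensor_class_frame)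

lemma mem_tensor_frame:
  "a \<in> carrier A \<Longrightarrow> p \<in> tensor_frame a \<longleftrightarrow>
    (\<exists>x y. p = (\<theta> x, \<psi> y) \<and> x \<in> carrier A \<and> y \<in> carrier A \<and> R x \<otimes> y = a)"
  by (simp add: tensor_frame_def tensor_class_frame)

lemma frame_pair_mem_iff [simp]:
  "\<lbrakk>a \<in> carrier A; x \<in> carrier A; y \<in> carrier A\<rbrakk> \<Longrightarrow>
    (\<theta> x, \<psi> y) \<in> tensor_frame a \<longleftrightarrow> R x \<otimes> y = a"
  by (subst mem_tensor_frame) (use X.frame_eq_iff Y.frame_eq_iff in blast)+

text \<open>Since \<open>f\<close> factors through the invariant, it is constant on the class, which
  is nonempty, so \<open>the_elem\<close> is meaningful. The maps out of tensor products are
  computed by this rule.\<close>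

lemma tensor_lift_frame:
  assumes "a \<in> carrier A"
    and "\<And>x y. \<lbrakk>x \<in> carrier A; y \<in> carrier A\<rbrakk> \<Longrightarrow> f (\<theta> x) (\<psi> y) = F (R x \<otimes> y)"
  shows "tensor_lift f (tensor_frame a) = F a"
proof -
  have "(\<lambda>(x, y). f x y) ` tensor_frame a = {F a}"
  proof
    show "(\<lambda>(x, y). f x y) ` tensor_frame a \<subseteq> {F a}"
      using assms by (auto simp: mem_tensor_frame)
    have "(\<theta> \<one>, \<psi> a) \<in> tensor_frame a"
      using assms(1) by simp
    then have "f (\<theta> \<one>) (\<psi> a) \<in> (\<lambda>(x, y). f x y) ` tensor_frame a" by force
    then show "{F a} \<subseteq> (\<lambda>(x, y). f x y) ` tensor_frame a" using assms by simp
  qed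
  then show ?thesis by (simp add: tensor_lift_def)
qed

lemma tensor_points: "points (tensor A X Y) = tensor_frame ` carrier A"
proof -
  have "tensor_class A X Y x y \<in> tensor_frame ` carrier A" if "x \<in> points X" "y \<in> points Y" for x y
    using that by (auto elim!: X.frame_cases Y.frame_cases simp: tensor_class_eq_frame)
  then show ?thesis
    by (force simp: tensor_def tensor_frame_def)
qed

lemma tensor_frame_inj: "inj_on tensor_frame (carrier A)"
proof (rule inj_onI)
  fix a b assume *: "a \<in> carrier A" "b \<in> carrier A" "tensor_frame a = tensor_frame b"
  then have "(\<theta> \<one>, \<psi> a) \<in> tensor_frame b" by (metis Y.Q_one X.l_one X.one_closed mem_tensor_frame)
  then show "a = b" using * by simp
qed

text \<open>The left action multiplies the first coordinate by \<open>Q a\<close>, which enters the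
  invariant through \<open>R\<close>; hence the composite. The result allows tensor products to be
  iterated.\<close>

lemma framed_tensor: "framed_biset A (tensor A X Y) tensor_frame (R \<circ> Q)"
proof
  show "R \<circ> Q \<in> monoid_hom A A"
    by (rule monoid_homI) (auto simp: X.Q_mult Y.Q_mult)
  show "bij_betw tensor_frame (carrier A) (points (tensor A X Y))"
    by (simp add: tensor_points bij_betw_def tensor_frame_inj)
  fix a b assume ab: "a \<in> carrier A" "b \<in> carrier A"
  show "lact (tensor A X Y) a (tensor_frame b) = tensor_frame ((R \<circ> Q) a \<otimes> b)"
    unfolding tensor_def biset.simps
    by (rule tensor_lift_frame [where F = "\<lambda>b. tensor_frame ((R \<circ> Q) a \<otimes> b)"])
      (use ab in \<open>auto simp: X.lact_frame tensor_class_eq_frame Y.Q_mult X.m_assoc\<close>)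
  show "ract (tensor A X Y) (tensor_frame a) b = tensor_frame (a \<otimes> b)"
    unfolding tensor_def biset.simps
    by (rule tensor_lift_frame [where F = "\<lambda>a. tensor_frame (a \<otimes> b)"])
      (use ab in \<open>auto simp: Y.ract_frame tensor_class_eq_frame X.m_assoc\<close>)
qed

end

text \<open>A separate locale: declared in \<open>framed_biset\<close> itself, these sublocales would apply again to the
  tensor square and never end.\<close>

locale framed_biset_powers = framed_biset A X \<theta> Q
  for A :: "('a, 'm) monoid_scheme" (structure) and X :: "('a, 'x) biset" and \<theta> Q
begin

sublocale square: framed_biset_pair A X \<theta> Q X \<theta> Q ..
sublocale square_biset: framed_biset A "tensor A X X" square.tensor_frame "Q \<circ> Q"
  by (rule square.framed_tensor)
sublocale left: framed_biset_pair A "tensor A X X" square.tensor_frame "Q \<circ> Q" X \<theta> Q ..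
sublocale right: framed_biset_pair A X \<theta> Q "tensor A X X" square.tensor_frame "Q \<circ> Q" ..
sublocale regular: framed_biset A "regular_biset A" id id
  by (rule framed_regular_biset) unfold_locales
sublocale lunit: framed_biset_pair A "regular_biset A" id id X \<theta> Q ..
sublocale runit: framed_biset_pair A X \<theta> Q "regular_biset A" id id ..

text \<open>The associator is the identity in coordinates because \<open>Q (Q x \<otimes> y)
  \<otimes> z = Q (Q x) \<otimes> (Q y \<otimes> z)\<close>.\<close>

lemma assoc_frame:
  assumes "a \<in> carrier A"
  shows "tensor_assoc A X X X (left.tensor_frame a) = right.tensor_frame a"
proof -
  have *: "tensor_lift (\<lambda>u v. tensor_class A X (tensor A X X) u (tensor_class A X X v (\<theta> y)))
      (square.tensor_frame x) = right.tensor_frame (Q x \<otimes> y)"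
    if "x \<in> carrier A" "y \<in> carrier A" for x y
    by (rule square.tensor_lift_frame [where F = "\<lambda>x. right.tensor_frame (Q x \<otimes> y)"])
      (use that in \<open>auto simp: square.tensor_class_eq_frame right.tensor_class_eq_frame Q_mult m_assoc\<close>)
  show ?thesis
    unfolding tensor_assoc_def
    by (rule left.tensor_lift_frame [where F = right.tensor_frame]) (use assms * in auto)
qed

lemma lunit_frame: "a \<in> carrier A \<Longrightarrow> tensor_lunit X (lunit.tensor_frame a) = \<theta> a"
  unfolding tensor_lunit_def
  by (rule lunit.tensor_lift_frame [where F = \<theta>]) (auto simp: lact_frame)

lemma runit_frame: "a \<in> carrier A \<Longrightarrow> tensor_runit X (runit.tensor_frame a) = \<theta> a"
  unfolding tensor_runit_def
  by (rule runit.tensor_lift_frame [where F = \<theta>]) (auto simp: ract_frame)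

section \<open>Comonoid structures on a framed biset\<close>

context
  fixes \<Delta> :: "'x \<Rightarrow> ('x \<times> 'x) set" and \<epsilon> :: "'x \<Rightarrow> 'a" and d e :: 'a
  assumes d: "d \<in> carrier A" and e: "e \<in> carrier A"
    and comul_frame: "\<And>a. a \<in> carrier A \<Longrightarrow> \<Delta> (\<theta> a) = square.tensor_frame (d \<otimes> a)"
    and counit_frame: "\<And>a. a \<in> carrier A \<Longrightarrow> \<epsilon> (\<theta> a) = e \<otimes> a"
begin

text \<open>Right linearity is built into \<open>comul_frame\<close>, so left linearity is the only
  condition, and testing it at \<open>\<theta> \<one>\<close> gives the stated equation.\<close>

lemma comul_hom_frame_iff:
  "\<Delta> \<in> biset_hom A X (tensor A X X) \<longleftrightarrow> (\<forall>a \<in> carrier A. d \<otimes> Q a = Q (Q a) \<otimes> d)"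
proof
  assume *: "\<Delta> \<in> biset_hom A X (tensor A X X)"
  show "\<forall>a \<in> carrier A. d \<otimes> Q a = Q (Q a) \<otimes> d"
  proof
    fix a assume a: "a \<in> carrier A"
    then have "\<Delta> (lact X a (\<theta> \<one>)) = lact (tensor A X X) a (\<Delta> (\<theta> \<one>))"
      using * by (simp add: biset_hom_def)
    then show "d \<otimes> Q a = Q (Q a) \<otimes> d"
      using a d by (simp add: lact_frame square_biset.lact_frame comul_frame)
  qed
next
  assume "\<forall>a \<in> carrier A. d \<otimes> Q a = Q (Q a) \<otimes> d"
  then have dQ: "d \<otimes> (Q a \<otimes> b) = Q (Q a) \<otimes> (d \<otimes> b)" if "a \<in> carrier A" "b \<in> carrier A" for a b
    using that d by (simp add: m_assoc [symmetric])
  show "\<Delta> \<in> biset_hom A X (tensor A X X)"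
    unfolding biset_hom_def using d
    by (auto elim!: frame_cases simp: comul_frame lact_frame ract_frame dQ m_assoc
        square_biset.lact_frame square_biset.ract_frame)
qed

lemma counit_hom_frame_iff:
  "\<epsilon> \<in> biset_hom A X (regular_biset A) \<longleftrightarrow> (\<forall>a \<in> carrier A. a \<otimes> e = e \<otimes> Q a)"
proof
  assume *: "\<epsilon> \<in> biset_hom A X (regular_biset A)"
  show "\<forall>a \<in> carrier A. a \<otimes> e = e \<otimes> Q a"
  proof
    fix a assume a: "a \<in> carrier A"
    then have "\<epsilon> (lact X a (\<theta> \<one>)) = a \<otimes> \<epsilon> (\<theta> \<one>)"
      using * by (simp add: biset_hom_def regular_biset_def)
    then show "a \<otimes> e = e \<otimes> Q a"
      using a e by (simp add: lact_frame counit_frame)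
  qed
next
  assume "\<forall>a \<in> carrier A. a \<otimes> e = e \<otimes> Q a"
  then have eQ: "e \<otimes> (Q a \<otimes> b) = a \<otimes> (e \<otimes> b)" if "a \<in> carrier A" "b \<in> carrier A" for a b
    using that e by (simp add: m_assoc [symmetric])
  show "\<epsilon> \<in> biset_hom A X (regular_biset A)"
    unfolding biset_hom_def regular_biset_def using e
    by (auto elim!: frame_cases simp: counit_frame lact_frame ract_frame eQ m_assoc)
qed

lemma left_comul_frame:
  assumes "a \<in> carrier A"
  shows "tensor_map A (tensor A X X) X \<Delta> id (square.tensor_frame a) = left.tensor_frame (Q d \<otimes> a)"
  unfolding tensor_map_def
  by (rule square.tensor_lift_frame [where F = "\<lambda>a. left.tensor_frame (Q d \<otimes> a)"])
    (use assms d in \<open>auto simp: comul_frame left.tensor_class_eq_frame Q_mult m_assoc\<close>)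

text \<open>The coordinate \<open>x\<close> of the first factor enters the triple product as
  \<open>Q (Q x)\<close>, to the left of \<open>d\<close>. Left linearity of the comultiplication
  turns \<open>Q (Q x) \<otimes> d\<close> into \<open>d \<otimes> Q x\<close>, so the map respects
  classes.\<close>

lemma right_comul_frame:
  assumes "a \<in> carrier A" and "\<forall>a \<in> carrier A. d \<otimes> Q a = Q (Q a) \<otimes> d"
  shows "tensor_map A X (tensor A X X) id \<Delta> (square.tensor_frame a) = right.tensor_frame (d \<otimes> a)"
  unfolding tensor_map_def
  by (rule square.tensor_lift_frame [where F = "\<lambda>a. right.tensor_frame (d \<otimes> a)"])
    (use assms d in \<open>auto simp: comul_frame right.tensor_class_eq_frame m_assoc [symmetric]\<close>)

lemma left_counit_frame:
  assumes "a \<in> carrier A"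
  shows "tensor_map A (regular_biset A) X \<epsilon> id (square.tensor_frame a) = lunit.tensor_frame (Q e \<otimes> a)"
  unfolding tensor_map_def
  by (rule square.tensor_lift_frame [where F = "\<lambda>a. lunit.tensor_frame (Q e \<otimes> a)"])
    (use assms e lunit.tensor_class_eq_frame in \<open>auto simp: counit_frame Q_mult m_assoc\<close>)

text \<open>Left linearity of the counit turns \<open>x \<otimes> e\<close> into
  \<open>e \<otimes> Q x\<close>, so the value depends on the class only.\<close>

lemma right_counit_frame:
  assumes "a \<in> carrier A" and "\<forall>a \<in> carrier A. a \<otimes> e = e \<otimes> Q a"
  shows "tensor_map A X (regular_biset A) id \<epsilon> (square.tensor_frame a) = runit.tensor_frame (e \<otimes> a)"
  unfolding tensor_map_def
  by (rule square.tensor_lift_frame [where F = "\<lambda>a. runit.tensor_frame (e \<otimes> a)"])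
    (use assms e runit.tensor_class_eq_frame in \<open>auto simp: counit_frame m_assoc [symmetric]\<close>)

text \<open>All maps involved are right linear, so coassociativity and the counit laws need only be
  checked at \<open>\<theta> \<one>\<close>, where injectivity of the frames turns them into
  equations in the monoid.\<close>

lemma biset_comonoid_frame_iff:
  "biset_comonoid A X \<Delta> \<epsilon> \<longleftrightarrow>
     (\<forall>a \<in> carrier A. d \<otimes> Q a = Q (Q a) \<otimes> d) \<and> (\<forall>a \<in> carrier A. a \<otimes> e = e \<otimes> Q a) \<and>
     Q d \<otimes> d = d \<otimes> d \<and> Q e \<otimes> d = \<one> \<and> e \<otimes> d = \<one>" (is "?L \<longleftrightarrow> ?R")
proof
  assume ?L
  then interpret biset_comonoid A X \<Delta> \<epsilon> .
  note hom = comul_hom [unfolded comul_hom_frame_iff] counit_hom [unfolded counit_hom_frame_iff]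
  note simps = comul_frame left_comul_frame right_comul_frame left_counit_frame
    right_counit_frame assoc_frame lunit_frame runit_frame
  have "Q d \<otimes> d = d \<otimes> d"
    using coassoc [of "\<theta> \<one>"] inj_onD [OF right.tensor_frame_inj] d hom by (simp add: simps)
  moreover have "Q e \<otimes> d = \<one>" "e \<otimes> d = \<one>"
    using counit_left [of "\<theta> \<one>"] counit_right [of "\<theta> \<one>"] d e hom by (simp_all add: simps)
  ultimately show ?R using hom by blast
next
  assume R: ?R
  note simps = comul_frame left_comul_frame right_comul_frame left_counit_frame
    right_counit_frame assoc_frame lunit_frame runit_frame
  show ?L
    by unfold_locales
      (use R d e in \<open>auto elim!: frame_cases
        simp: comul_hom_frame_iff counit_hom_frame_iff simps m_assoc [symmetric]\<close>)
qed

end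

text \<open>Right linear maps are determined by their values at \<open>\<theta> \<one>\<close>; the
  frame of the tensor square is surjective and so provides \<open>d\<close>.\<close>

lemma biset_comonoid_frameE:
  assumes "biset_comonoid A X \<Delta> \<epsilon>"
  obtains d e where "d \<in> carrier A" "e \<in> carrier A"
    "\<And>a. a \<in> carrier A \<Longrightarrow> \<Delta> (\<theta> a) = square.tensor_frame (d \<otimes> a)"
    "\<And>a. a \<in> carrier A \<Longrightarrow> \<epsilon> (\<theta> a) = e \<otimes> a"
proof -
  interpret biset_comonoid A X \<Delta> \<epsilon> by fact
  have "\<Delta> (\<theta> \<one>) \<in> points (tensor A X X)" "\<epsilon> (\<theta> \<one>) \<in> carrier A"
    using comul_hom counit_hom by (auto simp: biset_hom_def regular_biset_def)
  then obtain d where d: "d \<in> carrier A" "\<Delta> (\<theta> \<one>) = square.tensor_frame d"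
    using square_biset.frame_cases by blast
  have ract: "ract X (\<theta> \<one>) a = \<theta> a" if "a \<in> carrier A" for a
    using that by (simp add: ract_frame)
  have "\<Delta> (\<theta> a) = square.tensor_frame (d \<otimes> a)" "\<epsilon> (\<theta> a) = \<epsilon> (\<theta> \<one>) \<otimes> a" if "a \<in> carrier A" for a
    using comul_hom counit_hom that d ract [OF that]
    by (auto simp: biset_hom_def regular_biset_def square_biset.ract_frame
        dest!: spec [of _ a] bspec [of _ _ "\<theta> \<one>"])
  then show ?thesis using that d \<open>\<epsilon> (\<theta> \<one>) \<in> carrier A\<close> by blast
qed

end

section \<open>Source-regular bialgebroids in coordinates\<close>

text \<open>The formulas are forced: \<open>src G a\<close> and \<open>tgt G a\<close> are the right
  and left action of \<open>a\<close> on the unit \<open>\<theta> \<eta>\<close>. In a product of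
  \<open>\<theta> a\<close> and \<open>\<theta> b\<close>, write \<open>\<theta> a\<close> as
  \<open>\<theta> \<one>\<close> times \<open>src G a\<close>; left multiplication of
  \<open>\<theta> b\<close> by \<open>src G a\<close> contributes \<open>T a\<close>, and the two
  factors \<open>\<theta> \<one>\<close> contribute \<mu>.\<close>

locale bialgebroid_frame = mu_delta_monoid A T Q \<mu> \<eta> \<delta> \<epsilon>
  for A :: "('a, 'm) monoid_scheme" (structure) and T Q \<mu> \<eta> \<delta> \<epsilon> +
  fixes G :: "('a, 'g) bialgebroid" and \<theta> :: "'a \<Rightarrow> 'g"
  assumes bij_frame: "bij_betw \<theta> (carrier A) (carrier G)"
    and mult_frame: "\<lbrakk>a \<in> carrier A; b \<in> carrier A\<rbrakk> \<Longrightarrow> \<theta> a \<otimes>\<^bsub>G\<^esub> \<theta> b = \<theta> (\<mu> \<otimes> T a \<otimes> b)"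
    and one_frame: "\<one>\<^bsub>G\<^esub> = \<theta> \<eta>"
    and src_frame: "a \<in> carrier A \<Longrightarrow> src G a = \<theta> (\<eta> \<otimes> a)"
    and tgt_frame: "a \<in> carrier A \<Longrightarrow> tgt G a = \<theta> (Q a \<otimes> \<eta>)"
    and comul_frame: "a \<in> carrier A \<Longrightarrow> comul G (\<theta> a) = bialgebroid_tensor A G (\<theta> \<one>) (\<theta> (\<delta> \<otimes> a))"
    and counit_frame: "a \<in> carrier A \<Longrightarrow> counit G (\<theta> a) = \<epsilon> \<otimes> a"
begin

lemmas rw = rewrite_prefix2

lemma mult_src_frame:
  "\<lbrakk>a \<in> carrier A; b \<in> carrier A\<rbrakk> \<Longrightarrow> \<theta> a \<otimes>\<^bsub>G\<^esub> src G b = \<theta> (a \<otimes> b)"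
  by (simp add: src_frame mult_frame m_assoc rw [OF eta_T [symmetric]] rw [OF mu_eta])

lemma mult_tgt_frame:
  "\<lbrakk>a \<in> carrier A; b \<in> carrier A\<rbrakk> \<Longrightarrow> \<theta> a \<otimes>\<^bsub>G\<^esub> tgt G b = \<theta> (Q b \<otimes> a)"
  by (simp add: tgt_frame mult_frame m_assoc rw [OF T_Q] eta_T [symmetric] rw [OF mu_Q] rw [OF mu_eta])

sublocale B: framed_biset_powers A "bialgebroid_biset G" \<theta> Q
  by unfold_locales
    (simp_all add: bialgebroid_biset_def Q_hom bij_frame mult_src_frame mult_tgt_frame)

lemma frame_closed [simp]: "a \<in> carrier A \<Longrightarrow> \<theta> a \<in> carrier G"
  using bij_frame by (rule bij_betw_apply)

lemma frame_cases:
  assumes "g \<in> carrier G"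
  obtains a where "a \<in> carrier A" "g = \<theta> a"
  using assms bij_frame by (auto simp: bij_betw_def)

lemma src_mult_frame:
  "\<lbrakk>a \<in> carrier A; b \<in> carrier A\<rbrakk> \<Longrightarrow> src G a \<otimes>\<^bsub>G\<^esub> \<theta> b = \<theta> (T a \<otimes> b)"
  by (simp add: src_frame mult_frame m_assoc T_mult rw [OF mu_T_eta])

lemma tgt_mult_frame:
  "\<lbrakk>a \<in> carrier A; b \<in> carrier A\<rbrakk> \<Longrightarrow> tgt G a \<otimes>\<^bsub>G\<^esub> \<theta> b = \<theta> (\<mu> \<otimes> T (Q a) \<otimes> T \<eta> \<otimes> b)"
  by (simp add: tgt_frame mult_frame m_assoc T_mult)

lemma comul_tensor_frame:
  "a \<in> carrier A \<Longrightarrow> comul G (\<theta> a) = B.square.tensor_frame (\<delta> \<otimes> a)"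
  by (simp add: comul_frame B.square.tensor_frame_def)

lemma comulE:
  assumes "(g\<^sub>1, g\<^sub>2) \<in> comul G g" "g \<in> carrier G"
  obtains a x y where "a \<in> carrier A" "x \<in> carrier A" "y \<in> carrier A"
    "g = \<theta> a" "g\<^sub>1 = \<theta> x" "g\<^sub>2 = \<theta> y" "Q x \<otimes> y = \<delta> \<otimes> a"
proof -
  obtain a where a: "a \<in> carrier A" "g = \<theta> a"
    using assms(2) by (rule frame_cases)
  then show ?thesis
    using assms(1) that by (auto simp: comul_tensor_frame B.square.mem_tensor_frame)
qed

text \<open>Associativity amounts to \<open>mu_mu\<close> and \<open>mu_TT\<close>, the left unit
  law to \<open>mu_T_eta\<close>, the right one to \<open>mu_eta\<close> after moving \<eta> past
  \<open>T\<close>.\<close>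

lemma monoid_G: "monoid G"
proof
  fix x y z assume "x \<in> carrier G" "y \<in> carrier G" "z \<in> carrier G"
  then obtain a b c where "a \<in> carrier A" "b \<in> carrier A" "c \<in> carrier A" "x = \<theta> a" "y = \<theta> b" "z = \<theta> c"
    by (metis frame_cases)
  then show "x \<otimes>\<^bsub>G\<^esub> y \<in> carrier G" "x \<otimes>\<^bsub>G\<^esub> y \<otimes>\<^bsub>G\<^esub> z = x \<otimes>\<^bsub>G\<^esub> (y \<otimes>\<^bsub>G\<^esub> z)"
    by (simp_all add: mult_frame m_assoc T_mult rw [OF mu_mu] rw [OF mu_TT])
next
  show "\<one>\<^bsub>G\<^esub> \<in> carrier G" by (simp add: one_frame)
  fix x assume "x \<in> carrier G"
  then show "\<one>\<^bsub>G\<^esub> \<otimes>\<^bsub>G\<^esub> x = x" "x \<otimes>\<^bsub>G\<^esub> \<one>\<^bsub>G\<^esub> = x"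
    by (auto elim!: frame_cases
        simp: one_frame mult_frame mu_T_eta m_assoc eta_T [symmetric] rw [OF mu_eta])
qed

text \<open>The representatives enter only through \<open>Q x \<otimes> y\<close> and
  \<open>Q v \<otimes> w\<close>: the second supplies a \<delta>, and next to it
  \<open>QT_delta\<close> can rewrite \<open>Q (T x)\<close>. This is multiplicativity of the
  comultiplication in coordinates.\<close>

lemma comul_mult_frame:
  assumes "a \<in> carrier A" "b \<in> carrier A" "x \<in> carrier A" "y \<in> carrier A" "v \<in> carrier A" "w \<in> carrier A"
    and "Q x \<otimes> y = \<delta> \<otimes> a" "Q v \<otimes> w = \<delta> \<otimes> b"
  shows "\<delta> \<otimes> (\<mu> \<otimes> T a \<otimes> b) = Q (\<mu> \<otimes> T x \<otimes> v) \<otimes> (\<mu> \<otimes> T y \<otimes> w)"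
proof -
  note cl = assms(1-6)
  have "Q (\<mu> \<otimes> T x \<otimes> v) \<otimes> (\<mu> \<otimes> T y \<otimes> w) = Q \<mu> \<otimes> Q (T x) \<otimes> \<mu> \<otimes> T y \<otimes> (Q v \<otimes> w)"
    using cl by (simp add: Q_mult m_assoc rw [OF mu_Q [symmetric]] rw [OF T_Q])
  also have "\<dots> = Q \<mu> \<otimes> \<mu> \<otimes> (Q (T x) \<otimes> \<delta>) \<otimes> T y \<otimes> b"
    using cl by (simp add: assms(8) m_assoc rw [OF mu_Q] rw [OF delta_T])
  also have "\<dots> = Q \<mu> \<otimes> \<mu> \<otimes> T (\<mu> \<otimes> Q x \<otimes> \<eta> \<otimes> y) \<otimes> \<delta> \<otimes> b"
    using cl by (simp add: QT_delta T_mult m_assoc rw [OF mu_mu] rw [OF delta_T])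
  \<comment> \<open>\<mu> commutes with \<open>Q x\<close> and cancels against \<eta>, which
    reassembles the invariant of the first pair.\<close>
  also have "\<mu> \<otimes> Q x \<otimes> \<eta> \<otimes> y = \<delta> \<otimes> a"
    using cl by (simp add: mu_Q m_assoc rw [OF mu_eta] assms(7))
  also have "Q \<mu> \<otimes> \<mu> \<otimes> T (\<delta> \<otimes> a) \<otimes> \<delta> \<otimes> b = (Q \<mu> \<otimes> \<mu> \<otimes> T \<delta> \<otimes> \<delta>) \<otimes> (T a \<otimes> b)"
    using cl by (simp add: T_mult m_assoc rw [OF delta_T])
  also have "\<dots> = \<delta> \<otimes> (\<mu> \<otimes> T a \<otimes> b)"
    using cl by (simp only: delta_mu [symmetric]) (simp add: m_assoc)
  finally show ?thesis by simp
qed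

text \<open>\<open>Q x\<close> commutes with \<mu> and with values of \<open>T\<close>, so it moves
  inward to \<open>y\<close> and forms \<open>\<delta> \<otimes> c\<close>. Thus
  \<open>QT_delta\<close> covers all representatives.\<close>

lemma takeuchi_frame:
  assumes "a \<in> carrier A" "c \<in> carrier A" "x \<in> carrier A" "y \<in> carrier A" "Q x \<otimes> y = \<delta> \<otimes> c"
  shows "Q (T a \<otimes> x) \<otimes> y = Q x \<otimes> (\<mu> \<otimes> T (Q a) \<otimes> T \<eta> \<otimes> y)"
proof -
  have "Q x \<otimes> (\<mu> \<otimes> T (Q a) \<otimes> T \<eta> \<otimes> y) = \<mu> \<otimes> T (Q a) \<otimes> T \<eta> \<otimes> (Q x \<otimes> y)"
    using assms(1-4) by (simp add: m_assoc rw [OF mu_Q [symmetric]] rw [OF T_Q])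
  also have "\<dots> = \<mu> \<otimes> T (Q a) \<otimes> T \<eta> \<otimes> \<delta> \<otimes> c"
    using assms by (simp add: m_assoc)
  also have "\<dots> = Q (T a) \<otimes> \<delta> \<otimes> c"
    using assms by (simp only: QT_delta)
  finally show ?thesis using assms by (simp add: Q_mult m_assoc)
qed

lemma right_bialgebroid: "right_bialgebroid A G"
proof (intro right_bialgebroid.intro right_bialgebroid_axioms.intro)
  show "monoid A" by unfold_locales
  show "monoid G" by (rule monoid_G)
  show "src G \<in> monoid_hom A G"
    by (rule monoid_homI)
      (simp_all add: src_frame mult_frame one_frame T_mult m_assoc rw [OF mu_T_eta] rw [OF eta_T])
  show "tgt G \<in> monoid_hom (op_monoid A) G"
  proof (rule monoid_homI)
    fix a b assume "a \<in> carrier (op_monoid A)" "b \<in> carrier (op_monoid A)"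
    then have "a \<in> carrier A" "b \<in> carrier A" by (simp_all add: op_monoid_def)
    then show "tgt G (a \<otimes>\<^bsub>op_monoid A\<^esub> b) = tgt G a \<otimes>\<^bsub>G\<^esub> tgt G b"
      by (simp add: tgt_frame [of a] mult_tgt_frame op_monoid_def)
        (simp add: tgt_frame Q_mult m_assoc)
  qed (simp_all add: op_monoid_def tgt_frame one_frame)
  show "src G a \<otimes>\<^bsub>G\<^esub> tgt G b = tgt G b \<otimes>\<^bsub>G\<^esub> src G a" if "a \<in> carrier A" "b \<in> carrier A" for a b
    using that by (simp add: src_frame [of a] mult_tgt_frame)
      (simp add: src_frame [symmetric] tgt_frame mult_src_frame m_assoc)
  show "biset_comonoid A (bialgebroid_biset G) (comul G) (counit G)"
    by (subst B.biset_comonoid_frame_iff [OF delta_closed eps_closed comul_tensor_frame counit_frame])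
      (simp_all add: delta_Q eps_Q delta_delta Q_eps_delta eps_delta)
  show "bialgebroid_tensor A G (src G a \<otimes>\<^bsub>G\<^esub> g\<^sub>1) g\<^sub>2 = bialgebroid_tensor A G g\<^sub>1 (tgt G a \<otimes>\<^bsub>G\<^esub> g\<^sub>2)"
    if "a \<in> carrier A" "g \<in> carrier G" "(g\<^sub>1, g\<^sub>2) \<in> comul G g" for a g g\<^sub>1 g\<^sub>2
    using that takeuchi_frame
    by (auto elim!: comulE simp: src_mult_frame tgt_mult_frame B.square.tensor_class_eq_frame)
  show "comul G (g \<otimes>\<^bsub>G\<^esub> h) = bialgebroid_tensor A G (g\<^sub>1 \<otimes>\<^bsub>G\<^esub> h\<^sub>1) (g\<^sub>2 \<otimes>\<^bsub>G\<^esub> h\<^sub>2)"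
    if "g \<in> carrier G" "h \<in> carrier G" "(g\<^sub>1, g\<^sub>2) \<in> comul G g" "(h\<^sub>1, h\<^sub>2) \<in> comul G h" for g h g\<^sub>1 g\<^sub>2 h\<^sub>1 h\<^sub>2
  proof -
    obtain a x y where g: "a \<in> carrier A" "x \<in> carrier A" "y \<in> carrier A"
      "g = \<theta> a" "g\<^sub>1 = \<theta> x" "g\<^sub>2 = \<theta> y" "Q x \<otimes> y = \<delta> \<otimes> a"
      using \<open>(g\<^sub>1, g\<^sub>2) \<in> _\<close> \<open>g \<in> _\<close> by (rule comulE)
    obtain b v w where h: "b \<in> carrier A" "v \<in> carrier A" "w \<in> carrier A"
      "h = \<theta> b" "h\<^sub>1 = \<theta> v" "h\<^sub>2 = \<theta> w" "Q v \<otimes> w = \<delta> \<otimes> b"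
      using \<open>(h\<^sub>1, h\<^sub>2) \<in> _\<close> \<open>h \<in> _\<close> by (rule comulE)
    have "comul G (g \<otimes>\<^bsub>G\<^esub> h) = B.square.tensor_frame (\<delta> \<otimes> (\<mu> \<otimes> T a \<otimes> b))"
      using g h by (simp add: mult_frame comul_tensor_frame)
    also have "\<dots> = bialgebroid_tensor A G (g\<^sub>1 \<otimes>\<^bsub>G\<^esub> h\<^sub>1) (g\<^sub>2 \<otimes>\<^bsub>G\<^esub> h\<^sub>2)"
      unfolding comul_mult_frame [OF g(1) h(1) g(2,3) h(2,3) g(7) h(7)]
      using g h by (simp add: mult_frame B.square.tensor_class_eq_frame)
    finally show ?thesis .
  qed
  show "comul G \<one>\<^bsub>G\<^esub> = bialgebroid_tensor A G \<one>\<^bsub>G\<^esub> \<one>\<^bsub>G\<^esub>"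
    by (simp add: one_frame comul_tensor_frame B.square.tensor_class_eq_frame delta_eta)
  show "counit G \<one>\<^bsub>G\<^esub> = \<one>"
    by (simp add: one_frame counit_frame eps_eta)
  have src: "\<epsilon> \<otimes> (T (\<epsilon> \<otimes> a) \<otimes> b) = \<epsilon> \<otimes> (\<mu> \<otimes> T a \<otimes> b)" if "a \<in> carrier A" "b \<in> carrier A" for a b
    using that by (simp add: T_mult m_assoc rw [OF eps_mu])
  show "counit G (src G (counit G g) \<otimes>\<^bsub>G\<^esub> h) = counit G (g \<otimes>\<^bsub>G\<^esub> h)"
    if "g \<in> carrier G" "h \<in> carrier G" for g h
    using that src by (auto elim!: frame_cases simp: counit_frame src_mult_frame mult_frame)
  have tgt: "\<epsilon> \<otimes> (\<mu> \<otimes> T a \<otimes> b) = \<epsilon> \<otimes> (\<mu> \<otimes> T (Q (\<epsilon> \<otimes> a)) \<otimes> T \<eta> \<otimes> b)"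
    if "a \<in> carrier A" "b \<in> carrier A" for a b
  proof -
    \<comment> \<open>\<open>eps_mu\<close> puts everything between the leading \<epsilon> and
      \<open>b\<close> under \<open>T\<close>, where \<epsilon>Q(x)\<eta> = x\<epsilon>\<eta> = x
      applies with x = \<epsilon>a.\<close>
    have "\<epsilon> \<otimes> (\<mu> \<otimes> T (Q (\<epsilon> \<otimes> a)) \<otimes> T \<eta> \<otimes> b) = \<epsilon> \<otimes> T (\<epsilon> \<otimes> Q (\<epsilon> \<otimes> a) \<otimes> \<eta>) \<otimes> b"
      using that by (simp add: T_mult m_assoc rw [OF eps_mu])
    also have "\<epsilon> \<otimes> Q (\<epsilon> \<otimes> a) \<otimes> \<eta> = \<epsilon> \<otimes> a"
      using that by (simp add: eps_Q [symmetric] m_assoc eps_eta)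
    finally show ?thesis using that by (simp add: T_mult m_assoc rw [OF eps_mu])
  qed
  show "counit G (g \<otimes>\<^bsub>G\<^esub> h) = counit G (tgt G (counit G g) \<otimes>\<^bsub>G\<^esub> h)"
    if "g \<in> carrier G" "h \<in> carrier G" for g h
    using that tgt by (auto elim!: frame_cases simp: counit_frame tgt_mult_frame mult_frame)
qed

lemma source_regular: "source_regular A G"
  using bij_frame mult_src_frame by (auto simp: source_regular_def)

end

text \<open>Each coordinate equation is a bialgebroid law evaluated at
  \<open>\<theta> \<one>\<close> or at the unit; injectivity of \<theta>, or of the frame of the
  tensor square, carries it back to the monoid.\<close>

lemma bialgebroid_frame_exists:
  fixes A :: "('a, 'm) monoid_scheme" (structure)
  assumes "right_bialgebroid A G" "source_regular A G"
  obtains T Q \<mu> \<eta> \<delta> \<epsilon> \<theta> where "bialgebroid_frame A T Q \<mu> \<eta> \<delta> \<epsilon> G \<theta>"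
proof -
  interpret R: right_bialgebroid A G by fact
  obtain \<theta> where bij: "bij_betw \<theta> (carrier A) (carrier G)"
    and th_src: "\<And>a b. \<lbrakk>a \<in> carrier A; b \<in> carrier A\<rbrakk> \<Longrightarrow> \<theta> a \<otimes>\<^bsub>G\<^esub> src G b = \<theta> (a \<otimes> b)"
    using assms(2) by (auto simp: source_regular_def)
  note src = monoid_homD [OF R.src_hom]
  have tgt: "\<And>a. a \<in> carrier A \<Longrightarrow> tgt G a \<in> carrier G"
    "\<And>a b. \<lbrakk>a \<in> carrier A; b \<in> carrier A\<rbrakk> \<Longrightarrow> tgt G (a \<otimes> b) = tgt G b \<otimes>\<^bsub>G\<^esub> tgt G a"
    "tgt G \<one> = \<one>\<^bsub>G\<^esub>"
    using monoid_homD [OF R.tgt_hom] by (simp_all add: op_monoid_def)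
  have th_cl [simp]: "\<theta> a \<in> carrier G" if "a \<in> carrier A" for a
    using bij that by (rule bij_betw_apply)
  have th_eq: "\<theta> a = \<theta> b \<longleftrightarrow> a = b" if "a \<in> carrier A" "b \<in> carrier A" for a b
    using bij that by (auto simp: bij_betw_def dest: inj_onD)
  define \<kappa> where "\<kappa> = inv_into (carrier A) \<theta>"
  have k_cl: "\<kappa> g \<in> carrier A" and th_k: "\<theta> (\<kappa> g) = g" if "g \<in> carrier G" for g
    using that bij unfolding \<kappa>_def bij_betw_def by (metis inv_into_into, metis f_inv_into_f)
  \<comment> \<open>Multiplying by a source on the left or by a target on the right commutes with
    the right action, so the values at \<open>\<theta> \<one>\<close> determine these maps;
    \<open>T\<close> and \<open>Q\<close> are their coordinates.\<close>
  define T Q \<mu> \<eta> where "T = (\<lambda>a. \<kappa> (src G a \<otimes>\<^bsub>G\<^esub> \<theta> \<one>))" and "Q = (\<lambda>a. \<kappa> (\<theta> \<one> \<otimes>\<^bsub>G\<^esub> tgt G a))"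
    and "\<mu> = \<kappa> (\<theta> \<one> \<otimes>\<^bsub>G\<^esub> \<theta> \<one>)" and "\<eta> = \<kappa> \<one>\<^bsub>G\<^esub>"
  have cl [simp]: "\<mu> \<in> carrier A" "\<eta> \<in> carrier A"
    "\<And>a. a \<in> carrier A \<Longrightarrow> T a \<in> carrier A" "\<And>a. a \<in> carrier A \<Longrightarrow> Q a \<in> carrier A"
    by (simp_all add: T_def Q_def \<mu>_def \<eta>_def k_cl src tgt)
  have th: "\<theta> \<mu> = \<theta> \<one> \<otimes>\<^bsub>G\<^esub> \<theta> \<one>" "\<theta> \<eta> = \<one>\<^bsub>G\<^esub>"
    "\<And>a. a \<in> carrier A \<Longrightarrow> \<theta> (T a) = src G a \<otimes>\<^bsub>G\<^esub> \<theta> \<one>"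
    "\<And>a. a \<in> carrier A \<Longrightarrow> \<theta> (Q a) = \<theta> \<one> \<otimes>\<^bsub>G\<^esub> tgt G a"
    by (simp_all add: T_def Q_def \<mu>_def \<eta>_def th_k src tgt)
  have th_one: "\<theta> a = \<theta> \<one> \<otimes>\<^bsub>G\<^esub> src G a" if "a \<in> carrier A" for a
    using that by (simp add: th_src)
  have src_th: "src G a \<otimes>\<^bsub>G\<^esub> \<theta> b = \<theta> (T a \<otimes> b)" if "a \<in> carrier A" "b \<in> carrier A" for a b
    using that by (simp add: th_one [of b] th_src [symmetric] th R.G.m_assoc src)
  have th_tgt: "\<theta> b \<otimes>\<^bsub>G\<^esub> tgt G a = \<theta> (Q a \<otimes> b)" if "a \<in> carrier A" "b \<in> carrier A" for a b
    using that by (simp add: th_one [of b] th_src [symmetric] th R.G.m_assoc src tgt R.src_tgt_commute)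
  have mult: "\<theta> a \<otimes>\<^bsub>G\<^esub> \<theta> b = \<theta> (\<mu> \<otimes> T a \<otimes> b)" if "a \<in> carrier A" "b \<in> carrier A" for a b
  proof -
    have "\<theta> a \<otimes>\<^bsub>G\<^esub> \<theta> b = \<theta> \<one> \<otimes>\<^bsub>G\<^esub> \<theta> (T a \<otimes> b)"
      using that by (simp add: th_one [of a] R.G.m_assoc src src_th)
    also have "\<dots> = \<theta> \<mu> \<otimes>\<^bsub>G\<^esub> src G (T a \<otimes> b)"
      using that by (simp add: th_one [of "T a \<otimes> b"] R.G.m_assoc src th del: src(2))
    finally show ?thesis using that by (simp add: th_src R.A.m_assoc)
  qed
  have src_eq: "src G a = \<theta> (\<eta> \<otimes> a)" if "a \<in> carrier A" for a
    using that by (simp add: th_src [symmetric] th src)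
  have tgt_eq: "tgt G a = \<theta> (Q a \<otimes> \<eta>)" if "a \<in> carrier A" for a
    using that by (simp add: th_tgt [symmetric] th(2) tgt)
  have T_hom: "T \<in> monoid_hom A A"
  proof (rule monoid_homI)
    fix a b assume "a \<in> carrier A" "b \<in> carrier A"
    then have "\<theta> (T (a \<otimes> b)) = \<theta> (T a \<otimes> T b)"
      by (simp add: th(3) [of "a \<otimes> b"] src R.G.m_assoc src_th)
    then show "T (a \<otimes> b) = T a \<otimes> T b" using \<open>a \<in> _\<close> \<open>b \<in> _\<close> by (simp add: th_eq)
  next
    have "\<theta> (T \<one>) = \<theta> \<one>" by (simp add: th src)
    then show "T \<one> = \<one>" by (simp add: th_eq)
  qed simp
  have Q_hom: "Q \<in> monoid_hom A A"
  proof (rule monoid_homI)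
    fix a b assume "a \<in> carrier A" "b \<in> carrier A"
    then have "\<theta> (Q (a \<otimes> b)) = \<theta> (Q a \<otimes> Q b)"
      by (simp add: th tgt R.G.m_assoc [symmetric] th_tgt [symmetric])
    then show "Q (a \<otimes> b) = Q a \<otimes> Q b" using \<open>a \<in> _\<close> \<open>b \<in> _\<close> by (simp add: th_eq)
  next
    have "\<theta> (Q \<one>) = \<theta> \<one>" by (simp add: th tgt)
    then show "Q \<one> = \<one>" by (simp add: th_eq)
  qed simp
  interpret B: framed_biset_powers A "bialgebroid_biset G" \<theta> Q
    by unfold_locales
      (simp_all add: bialgebroid_biset_def Q_hom bij th_src th_tgt)
  obtain \<delta> \<epsilon> where [simp]: "\<delta> \<in> carrier A" "\<epsilon> \<in> carrier A"
    and comul: "\<And>a. a \<in> carrier A \<Longrightarrow> comul G (\<theta> a) = B.square.tensor_frame (\<delta> \<otimes> a)"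
    and counit: "\<And>a. a \<in> carrier A \<Longrightarrow> counit G (\<theta> a) = \<epsilon> \<otimes> a"
    using B.biset_comonoid_frameE [OF R.comonoid] by blast
  note comonoid = R.comonoid [unfolded B.biset_comonoid_frame_iff [OF \<open>\<delta> \<in> _\<close> \<open>\<epsilon> \<in> _\<close> comul counit, simplified]]
  note T_mult = monoid_homD(2) [OF T_hom]
  note frame_eqI = inj_onD [OF B.square.tensor_frame_inj]
  \<comment> \<open>Both sides are the coordinate of \<open>src G a\<close>,
    \<open>\<theta> \<one>\<close>, \<open>tgt G b\<close> multiplied in this order, under the two
    bracketings.\<close>
  have T_Q: "T a \<otimes> Q b = Q b \<otimes> T a" if "a \<in> carrier A" "b \<in> carrier A" for a b
  proof -
    have "\<theta> (T a \<otimes> Q b) = \<theta> (Q b \<otimes> T a)"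
      using that by (simp add: src_th [symmetric] th_tgt [symmetric] th R.G.m_assoc src tgt)
    then show ?thesis using that by (simp add: th_eq)
  qed
  have eta_T: "\<eta> \<otimes> a = T a \<otimes> \<eta>" if "a \<in> carrier A" for a
  proof -
    have "\<theta> (\<eta> \<otimes> a) = \<theta> (T a \<otimes> \<eta>)"
      using that by (simp add: src_th [of a \<eta>, symmetric] th_src [of \<eta> a, symmetric] th(2) src)
    then show ?thesis using that by (simp add: th_eq)
  qed
  \<comment> \<open>Two evaluations of the product of \<open>src G a\<close> with two factors
    \<open>\<theta> \<one>\<close>; \<open>mu_Q\<close> uses \<open>tgt G a\<close> on the right
    instead.\<close>
  have mu_TT: "\<mu> \<otimes> T (T a) = T a \<otimes> \<mu>" if "a \<in> carrier A" for a
  proof -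
    have "\<theta> (\<mu> \<otimes> T (T a)) = \<theta> (T a) \<otimes>\<^bsub>G\<^esub> \<theta> \<one>" using that by (simp add: mult)
    also have "\<dots> = \<theta> (T a \<otimes> \<mu>)"
      using that by (simp add: src_th [symmetric] th R.G.m_assoc src)
    finally show ?thesis using that by (simp add: th_eq)
  qed
  have mu_Q: "\<mu> \<otimes> Q a = Q a \<otimes> \<mu>" if "a \<in> carrier A" for a
  proof -
    have "\<theta> (\<mu> \<otimes> Q a) = \<theta> \<one> \<otimes>\<^bsub>G\<^esub> \<theta> (Q a)" using that by (simp add: mult monoid_homD(3) [OF T_hom])
    also have "\<dots> = \<theta> (Q a \<otimes> \<mu>)"
      using that by (simp add: th_tgt [symmetric] th R.G.m_assoc tgt)
    finally show ?thesis using that by (simp add: th_eq)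
  qed
  have mu_mu: "\<mu> \<otimes> T \<mu> = \<mu> \<otimes> \<mu>"
  proof -
    have "\<theta> (\<mu> \<otimes> T \<mu>) = \<theta> \<mu> \<otimes>\<^bsub>G\<^esub> \<theta> \<one>" by (simp add: mult)
    also have "\<dots> = \<theta> \<one> \<otimes>\<^bsub>G\<^esub> \<theta> \<mu>" by (simp add: th R.G.m_assoc)
    also have "\<dots> = \<theta> (\<mu> \<otimes> \<mu>)" by (simp add: mult monoid_homD(3) [OF T_hom])
    finally show ?thesis by (simp add: th_eq)
  qed
  have mu_eta: "\<mu> \<otimes> \<eta> = \<one>"
  proof -
    have "\<theta> (\<mu> \<otimes> \<eta>) = \<theta> \<one>"
      using mult [of \<one> \<eta>] by (simp add: th(2) monoid_homD(3) [OF T_hom] del: B.frame_eq_iff)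
    then show ?thesis by (simp add: th_eq)
  qed
  have mu_T_eta: "\<mu> \<otimes> T \<eta> = \<one>"
  proof -
    have "\<theta> (\<mu> \<otimes> T \<eta>) = \<theta> \<one>"
      using mult [of \<eta> \<one>] by (simp add: th(2) del: B.frame_eq_iff)
    then show ?thesis by (simp add: th_eq)
  qed
  have delta_eta: "\<delta> \<otimes> \<eta> = Q \<eta> \<otimes> \<eta>"
  proof (rule frame_eqI)
    show "B.square.tensor_frame (\<delta> \<otimes> \<eta>) = B.square.tensor_frame (Q \<eta> \<otimes> \<eta>)"
      using R.comul_one
      by (simp add: th(2) [symmetric] comul B.square.tensor_class_eq_frame del: th(2))
  qed simp_all
  \<comment> \<open>The comultiplication axioms below are evaluated at this representative.\<close>
  have mem: "(\<theta> \<one>, \<theta> \<delta>) \<in> comul G (\<theta> \<one>)"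
    by (simp add: comul)
  have delta_T: "\<delta> \<otimes> T a = T a \<otimes> \<delta>" if a: "a \<in> carrier A" for a
  proof (rule frame_eqI)
    \<comment> \<open>By right linearity the comultiplication sends \<open>src G a\<close> to the
      class of the unit and \<open>src G a\<close>. Multiplying by its value at
      \<open>\<theta> \<one>\<close> computes its value at \<open>\<theta> (T a)\<close> a second
      time.\<close>
    have "(\<one>\<^bsub>G\<^esub>, src G a) \<in> comul G (src G a)"
      unfolding src_eq [OF a] th(2) [symmetric]
      using a by (simp add: comul) (simp add: R.A.m_assoc [symmetric] delta_eta)
    then have "comul G (src G a \<otimes>\<^bsub>G\<^esub> \<theta> \<one>) = bialgebroid_tensor A G (\<one>\<^bsub>G\<^esub> \<otimes>\<^bsub>G\<^esub> \<theta> \<one>) (src G a \<otimes>\<^bsub>G\<^esub> \<theta> \<delta>)"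
      using a mem by (intro R.comul_mult) (simp_all add: src)
    then show "B.square.tensor_frame (\<delta> \<otimes> T a) = B.square.tensor_frame (T a \<otimes> \<delta>)"
      using a by (simp add: src_th comul B.square.tensor_class_eq_frame)
  qed (use a in simp_all)
  have QT_delta: "Q (T a) \<otimes> \<delta> = \<mu> \<otimes> T (Q a) \<otimes> T \<eta> \<otimes> \<delta>" if a: "a \<in> carrier A" for a
  proof (rule frame_eqI)
    show "B.square.tensor_frame (Q (T a) \<otimes> \<delta>) = B.square.tensor_frame (\<mu> \<otimes> T (Q a) \<otimes> T \<eta> \<otimes> \<delta>)"
      using R.takeuchi [OF a _ mem] a
      by (simp add: src_th tgt_eq mult B.square.tensor_class_eq_frame T_mult R.A.m_assoc)
  qed (use a in simp_all)
  have delta_mu: "\<delta> \<otimes> \<mu> = Q \<mu> \<otimes> \<mu> \<otimes> T \<delta> \<otimes> \<delta>"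
  proof (rule frame_eqI)
    show "B.square.tensor_frame (\<delta> \<otimes> \<mu>) = B.square.tensor_frame (Q \<mu> \<otimes> \<mu> \<otimes> T \<delta> \<otimes> \<delta>)"
      using R.comul_mult [OF _ _ mem mem]
      by (simp add: mult comul B.square.tensor_class_eq_frame monoid_homD(3) [OF T_hom] R.A.m_assoc)
  qed simp_all
  have eps_mu: "\<epsilon> \<otimes> \<mu> = \<epsilon> \<otimes> T \<epsilon>"
    using R.counit_src [of "\<theta> \<one>" "\<theta> \<one>"]
    by (simp add: counit src_th mult monoid_homD(3) [OF T_hom])
  have eps_eta: "\<epsilon> \<otimes> \<eta> = \<one>"
    using R.counit_one counit [of \<eta>] by (simp add: th)
  have "bialgebroid_frame A T Q \<mu> \<eta> \<delta> \<epsilon> G \<theta>"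
  proof unfold_locales
    show "comul G (\<theta> a) = bialgebroid_tensor A G (\<theta> \<one>) (\<theta> (\<delta> \<otimes> a))" if "a \<in> carrier A" for a
      using that by (simp add: comul B.square.tensor_frame_def)
  qed (use comonoid in \<open>simp_all add: T_hom Q_hom T_Q eta_T mu_TT mu_Q mu_mu mu_eta mu_T_eta delta_eta
      delta_T QT_delta delta_mu eps_mu eps_eta bij mult th src_eq tgt_eq counit\<close>)
  then show ?thesis by (rule that)
qed

section \<open>Isomorphisms of skew monoidal monoids\<close>

text \<open>By surjectivity the unit is some \<open>h a\<close>, and then h(1) = h(a)h(1) = h(a1) =
  1.\<close>

lemma iso_monoid_hom:
  assumes "monoid A" "monoid B" "h \<in> iso A B"
  shows "h \<in> monoid_hom A B"
proof -
  interpret A: monoid A by fact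
  interpret B: monoid B by fact
  have h: "h \<in> hom A B" "h ` carrier A = carrier B" using assms(3) by (auto simp: iso_iff)
  then have one: "h \<one>\<^bsub>A\<^esub> \<in> carrier B" by (auto simp: hom_def)
  obtain a where a: "a \<in> carrier A" "h a = \<one>\<^bsub>B\<^esub>" using h(2) B.one_closed by (metis imageE)
  have "h \<one>\<^bsub>A\<^esub> = h a \<otimes>\<^bsub>B\<^esub> h \<one>\<^bsub>A\<^esub>" using a one by simp
  also have "\<dots> = \<one>\<^bsub>B\<^esub>" using h a by (metis A.one_closed A.r_one hom_mult)
  finally show ?thesis using h by (simp add: monoid_hom_def)
qed

lemma iso_inv_into:
  assumes "monoid A" "h \<in> iso A B"
  shows "inv_into (carrier A) h \<in> iso B A"
proof -
  interpret monoid A by fact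
  have bij: "bij_betw h (carrier A) (carrier B)" and hom: "h \<in> hom A B"
    using assms(2) by (auto simp: iso_def)
  note inv = bij_betw_inv_into_left [OF bij] bij_betw_inv_into_right [OF bij]
    bij_betw_apply [OF bij_betw_inv_into [OF bij]]
  have "inv_into (carrier A) h (x \<otimes>\<^bsub>B\<^esub> y) = inv_into (carrier A) h x \<otimes>\<^bsub>A\<^esub> inv_into (carrier A) h y"
    if xy: "x \<in> carrier B" "y \<in> carrier B" for x y
  proof -
    have "x \<otimes>\<^bsub>B\<^esub> y = h (inv_into (carrier A) h x \<otimes>\<^bsub>A\<^esub> inv_into (carrier A) h y)"
      using hom xy inv by (simp add: hom_mult)
    then show ?thesis using xy inv by simp
  qed
  then show ?thesis
    using bij_betw_inv_into [OF bij] inv by (auto simp: iso_def hom_def)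
qed

lemma (in monoid) Units_swap:
  assumes "u \<in> Units G" "x \<in> carrier G" "y \<in> carrier G" "u \<otimes> x = y \<otimes> u"
  shows "inv u \<otimes> y = x \<otimes> inv u"
proof -
  have "inv u \<otimes> y = inv u \<otimes> (y \<otimes> u) \<otimes> inv u"
    using assms(1-3) by (simp add: m_assoc Units_closed)
  also have "\<dots> = x \<otimes> inv u"
    using assms(1-3) by (simp add: assms(4) [symmetric] m_assoc [symmetric] Units_closed)
  finally show ?thesis .
qed

lemma (in monoid) Units_monoid_hom:
  assumes "h \<in> monoid_hom G G" "u \<in> Units G"
  shows "h u \<in> Units G"
proof -
  have "h u \<in> carrier G" "h (inv u) \<in> carrier G" "h u \<otimes> h (inv u) = \<one>" "h (inv u) \<otimes> h u = \<one>"
    using assms by (simp_all add: monoid_homD Units_closed monoid_homD(2) [OF assms(1), symmetric])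
  then show ?thesis by (auto simp: Units_def)
qed

text \<open>Isomorphisms with \<open>\<phi>\<^sub>0 = 1\<close>, written in terms of \<open>u = \<phi>\<^sub>2\<^sup>-\<^sup>1\<close>.\<close>

definition mu_delta_isomorphism ::
  "('a, 'm) monoid_scheme \<Rightarrow> 'a smm_md \<Rightarrow> 'a smm_md \<Rightarrow> ('a \<Rightarrow> 'a) \<Rightarrow> 'a \<Rightarrow> bool" where
  "mu_delta_isomorphism A M N \<phi> u \<longleftrightarrow> \<phi> \<in> iso A A \<and> u \<in> Units A \<and>
     (\<forall>a \<in> carrier A. u \<otimes>\<^bsub>A\<^esub> \<phi> (md_Q M a) = md_Q N (\<phi> a) \<otimes>\<^bsub>A\<^esub> u) \<and>
     (\<forall>a \<in> carrier A. u \<otimes>\<^bsub>A\<^esub> \<phi> (md_T M a) = md_T N (\<phi> a) \<otimes>\<^bsub>A\<^esub> u) \<and>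
     u \<otimes>\<^bsub>A\<^esub> \<phi> (md_mu M) = md_mu N \<otimes>\<^bsub>A\<^esub> md_T N u \<otimes>\<^bsub>A\<^esub> u \<and>
     u \<otimes>\<^bsub>A\<^esub> \<phi> (md_eta M) = md_eta N \<and>
     md_Q N u \<otimes>\<^bsub>A\<^esub> u \<otimes>\<^bsub>A\<^esub> \<phi> (md_delta M) = md_delta N \<otimes>\<^bsub>A\<^esub> u \<and>
     md_eps N \<otimes>\<^bsub>A\<^esub> u = \<phi> (md_eps M)"

locale mu_delta_pair =
  M: mu_delta_monoid A "md_T M" "md_Q M" "md_mu M" "md_eta M" "md_delta M" "md_eps M" +
  N: mu_delta_monoid A "md_T N" "md_Q N" "md_mu N" "md_eta N" "md_delta N" "md_eps N"
  for A :: "('a, 'm) monoid_scheme" (structure) and M N :: "'a smm_md"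
begin

lemmas rw = M.rewrite_prefix2

text \<open>The condition on \<gamma> is the product of those on \<mu> and \<delta>; the factor
  \<open>md_T N u\<close> from the former cancels against \<open>md_T N v\<close>.\<close>

lemma smm_isomorphism_of_mu_delta:
  assumes "mu_delta_isomorphism A M N \<phi> u"
  shows "smm_isomorphism A (smm_of_md A M) A (smm_of_md A N) \<phi> (inv u) \<one>"
proof -
  have iso: "\<phi> \<in> iso A A" and u: "u \<in> Units A" and mu: "u \<otimes> \<phi> (md_mu M) = md_mu N \<otimes> md_T N u \<otimes> u"
    and eta: "u \<otimes> \<phi> (md_eta M) = md_eta N" and eps: "md_eps N \<otimes> u = \<phi> (md_eps M)"
    and delta: "md_Q N u \<otimes> u \<otimes> \<phi> (md_delta M) = md_delta N \<otimes> u"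
    using assms by (auto simp: mu_delta_isomorphism_def)
  note hom = monoid_homD [OF iso_monoid_hom [OF M.monoid_axioms M.monoid_axioms iso]]
  define v where "v = inv u"
  have cl [simp]: "u \<in> carrier A" "v \<in> carrier A" using u by (auto simp: v_def)
  have uv: "u \<otimes> v = \<one>" "v \<otimes> u = \<one>" using u by (simp_all add: v_def)
  note Quv = N.Q_mult [OF cl, unfolded uv N.Q_one, symmetric] N.Q_mult [OF cl(2,1), unfolded uv N.Q_one, symmetric]
  note Tuv = N.T_mult [OF cl, unfolded uv N.T_one, symmetric]
  have mu': "\<phi> (md_mu M) = v \<otimes> md_mu N \<otimes> md_T N u \<otimes> u"
  proof -
    have "\<phi> (md_mu M) = v \<otimes> (u \<otimes> \<phi> (md_mu M))" by (simp add: rw [OF uv(2)] hom)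
    then show ?thesis unfolding mu by (simp add: M.m_assoc)
  qed
  have delta': "u \<otimes> \<phi> (md_delta M) = md_Q N v \<otimes> md_delta N \<otimes> u"
  proof -
    have "u \<otimes> \<phi> (md_delta M) = md_Q N v \<otimes> (md_Q N u \<otimes> u \<otimes> \<phi> (md_delta M))"
      by (simp add: M.m_assoc rw [OF Quv(2)] hom)
    then show ?thesis unfolding delta by (simp add: M.m_assoc)
  qed
  have "\<phi> (md_mu M \<otimes> md_delta M) \<otimes> v \<otimes> md_T N v
      = v \<otimes> md_mu N \<otimes> md_T N u \<otimes> (u \<otimes> \<phi> (md_delta M)) \<otimes> v \<otimes> md_T N v"
    by (simp add: hom mu' M.m_assoc)
  also have "\<dots> = v \<otimes> md_mu N \<otimes> md_T N u \<otimes> md_Q N v \<otimes> md_delta N \<otimes> md_T N v"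
    unfolding delta' by (simp add: M.m_assoc rw [OF uv(1)])
  also have "\<dots> = v \<otimes> md_Q N v \<otimes> (md_mu N \<otimes> md_delta N)"
    by (simp add: M.m_assoc rw [OF N.T_Q] rw [OF N.mu_Q] N.delta_T rw [OF Tuv])
  finally have gamma: "\<phi> (md_mu M \<otimes> md_delta M) \<otimes> v \<otimes> md_T N v = v \<otimes> md_Q N v \<otimes> (md_mu N \<otimes> md_delta N)" .
  have "v \<otimes> md_eta N = \<phi> (md_eta M)" by (simp add: eta [symmetric] rw [OF uv(2)] hom)
  moreover have "\<phi> (md_eps M) \<otimes> v = md_eps N" by (simp add: eps [symmetric] M.m_assoc uv)
  ultimately show ?thesis
    unfolding smm_isomorphism_def smm_of_md_def v_def [symmetric]
    using iso u gamma assms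
    by (auto simp: v_def hom mu_delta_isomorphism_def intro!: M.Units_swap)
qed

text \<open>Conjugation by \<open>\<phi>\<^sub>0\<close> makes an isomorphism strict on units.\<close>

lemma smm_isomorphism_normalize:
  assumes "smm_isomorphism A (smm_of_md A M) A (smm_of_md A N) \<phi> p q"
  shows "smm_isomorphism A (smm_of_md A M) A (smm_of_md A N)
    (\<lambda>a. inv q \<otimes> \<phi> a \<otimes> q) (inv q \<otimes> p \<otimes> md_Q N q \<otimes> md_T N q) \<one>"
proof -
  have iso: "\<phi> \<in> iso A A" and p: "p \<in> Units A" and q: "q \<in> Units A"
    and Q: "\<And>a. a \<in> carrier A \<Longrightarrow> p \<otimes> md_Q N (\<phi> a) = \<phi> (md_Q M a) \<otimes> p"
    and T: "\<And>a. a \<in> carrier A \<Longrightarrow> p \<otimes> md_T N (\<phi> a) = \<phi> (md_T M a) \<otimes> p"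
    and gamma: "\<phi> (md_mu M \<otimes> md_delta M) \<otimes> p \<otimes> md_T N p = p \<otimes> md_Q N p \<otimes> (md_mu N \<otimes> md_delta N)"
    and eta: "p \<otimes> md_Q N q \<otimes> md_eta N = \<phi> (md_eta M)"
    and eps: "\<phi> (md_eps M) \<otimes> p \<otimes> md_T N q = md_eps N"
    using assms by (auto simp: smm_isomorphism_def smm_of_md_def)
  note hom = monoid_homD [OF iso_monoid_hom [OF M.monoid_axioms M.monoid_axioms iso]]
  define r where "r = inv q"
  have cl [simp]: "p \<in> carrier A" "q \<in> carrier A" "r \<in> carrier A" using p q by (auto simp: r_def)
  have qr: "q \<otimes> r = \<one>" "r \<otimes> q = \<one>" using q by (simp_all add: r_def)
  note Qqr = N.Q_mult [OF cl(2,3), unfolded qr N.Q_one, symmetric]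
  note Tqr = N.T_mult [OF cl(2,3), unfolded qr N.T_one, symmetric]
  define g where "g = md_mu N \<otimes> md_delta N"
  have [simp]: "g \<in> carrier A" by (simp add: g_def)
  interpret S: skew_monoidal_monoid A N.to_smm by (rule N.skew_monoidal_monoid_to_smm)
  have g_TT: "g \<otimes> md_T N (md_T N a) = md_T N a \<otimes> g" and g_TQ: "g \<otimes> md_T N (md_Q N a) = md_Q N (md_T N a) \<otimes> g"
    and g_Q: "g \<otimes> md_Q N a = md_Q N (md_Q N a) \<otimes> g" if "a \<in> carrier A" for a
    using S.gamma_TT S.gamma_TQ S.gamma_Q that by (simp_all add: N.to_smm_def g_def)
  \<comment> \<open>\<open>r\<close> belongs to the outer conjugation, while \<open>md_Q N q\<close>
    and \<open>md_T N q\<close> absorb the conjugation inside the arguments of the two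
    endomorphisms.\<close>
  define p' where "p' = r \<otimes> p \<otimes> md_Q N q \<otimes> md_T N q"
  have "p' \<in> Units A"
    using M.Units_monoid_hom [OF N.Q_hom q] M.Units_monoid_hom [OF N.T_hom q] p q
    by (simp add: p'_def r_def)
  have [simp]: "p' \<in> carrier A" by (simp add: p'_def)
  have bij: "bij_betw (\<lambda>a. r \<otimes> a \<otimes> q) (carrier A) (carrier A)"
    by (rule bij_betw_byWitness [where f' = "\<lambda>a. q \<otimes> a \<otimes> r"])
      (auto simp: M.m_assoc rw [OF qr(1)] rw [OF qr(2)] qr)
  have "bij_betw (\<lambda>a. r \<otimes> \<phi> a \<otimes> q) (carrier A) (carrier A)"
    using bij_betw_trans [OF _ bij, of \<phi> "carrier A"] iso by (simp add: iso_def comp_def)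
  then have iso': "(\<lambda>a. r \<otimes> \<phi> a \<otimes> q) \<in> iso A A"
    by (auto simp: iso_def hom_def hom M.m_assoc rw [OF qr(1)])
  have Q': "p' \<otimes> md_Q N (r \<otimes> \<phi> a \<otimes> q) = r \<otimes> \<phi> (md_Q M a) \<otimes> q \<otimes> p'" if a: "a \<in> carrier A" for a
    using a by (simp add: p'_def M.m_assoc N.Q_mult hom rw [OF N.T_Q] N.T_Q rw [OF Qqr] rw [OF qr(1)] rw [OF Q])
  have T': "p' \<otimes> md_T N (r \<otimes> \<phi> a \<otimes> q) = r \<otimes> \<phi> (md_T M a) \<otimes> q \<otimes> p'" if a: "a \<in> carrier A" for a
  proof -
    have "p' \<otimes> md_T N (r \<otimes> \<phi> a \<otimes> q) = r \<otimes> (p \<otimes> md_T N (\<phi> a)) \<otimes> md_Q N q \<otimes> md_T N q"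
      using a by (simp add: p'_def M.m_assoc N.T_mult hom rw [OF Tqr] rw [OF N.T_Q])
    then show ?thesis
      using a by (simp add: T p'_def M.m_assoc hom rw [OF qr(1)])
  qed
  \<comment> \<open>Cancelling \<open>q\<close> against \<open>r\<close>, outside and under
    \<open>md_T N\<close>, exposes the original condition on \<gamma>. The remaining factors pass
    through \<open>g\<close> by its naturality and assemble to \<open>md_Q N p'\<close>.\<close>
  have "r \<otimes> \<phi> (md_mu M \<otimes> md_delta M) \<otimes> q \<otimes> p' \<otimes> md_T N p'
      = r \<otimes> (\<phi> (md_mu M \<otimes> md_delta M) \<otimes> p \<otimes> md_T N p) \<otimes> md_Q N q \<otimes> md_T N (md_Q N q) \<otimes> md_T N (md_T N q)"
    by (simp add: p'_def M.m_assoc hom N.T_mult rw [OF qr(1)] rw [OF Tqr] rw [OF N.T_Q])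
  also have "\<dots> = r \<otimes> (p \<otimes> md_Q N p \<otimes> g) \<otimes> md_Q N q \<otimes> md_T N (md_Q N q) \<otimes> md_T N (md_T N q)"
    by (simp only: gamma g_def)
  also have "\<dots> = r \<otimes> p \<otimes> md_Q N p \<otimes> md_Q N (md_Q N q) \<otimes> md_Q N (md_T N q) \<otimes> md_T N q \<otimes> g"
    by (simp add: M.m_assoc rw [OF g_Q] rw [OF g_TQ] g_TT)
  also have "\<dots> = p' \<otimes> md_Q N p' \<otimes> g"
    by (simp add: p'_def M.m_assoc N.Q_mult N.T_Q rw [OF N.T_Q] rw [OF Qqr])
  finally have gamma': "r \<otimes> \<phi> (md_mu M \<otimes> md_delta M) \<otimes> q \<otimes> p' \<otimes> md_T N p' = p' \<otimes> md_Q N p' \<otimes> g" .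
  have eta': "p' \<otimes> md_eta N = r \<otimes> \<phi> (md_eta M) \<otimes> q"
    by (simp add: p'_def M.m_assoc N.eta_T [symmetric] eta [symmetric])
  have "r \<otimes> \<phi> (md_eps M) \<otimes> q \<otimes> p' = r \<otimes> (\<phi> (md_eps M) \<otimes> p \<otimes> md_T N q) \<otimes> md_Q N q"
    by (simp add: p'_def M.m_assoc hom rw [OF qr(1)] N.T_Q)
  also have "\<dots> = md_eps N"
    by (simp add: eps M.m_assoc N.eps_Q [symmetric] rw [OF qr(2)])
  finally have eps': "r \<otimes> \<phi> (md_eps M) \<otimes> q \<otimes> p' = md_eps N" .
  show ?thesis
    unfolding smm_isomorphism_def smm_of_md_def r_def [symmetric] p'_def [symmetric]
    using iso' \<open>p' \<in> Units A\<close> Q' T' gamma' eta' eps' by (simp add: g_def)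
qed

text \<open>Because \<mu> = Q(\<epsilon>)\<gamma> and \<delta> = \<gamma>T(\<eta>), the conditions
  on \<mu> and \<delta> follow from the one on \<gamma> combined with those on \<epsilon> and
  \<eta>.\<close>

lemma mu_delta_of_smm_isomorphism:
  assumes "smm_isomorphism A (smm_of_md A M) A (smm_of_md A N) \<phi> p \<one>"
  shows "mu_delta_isomorphism A M N \<phi> (inv p)"
proof -
  have iso: "\<phi> \<in> iso A A" and p: "p \<in> Units A"
    and Q: "\<And>a. a \<in> carrier A \<Longrightarrow> p \<otimes> md_Q N (\<phi> a) = \<phi> (md_Q M a) \<otimes> p"
    and T: "\<And>a. a \<in> carrier A \<Longrightarrow> p \<otimes> md_T N (\<phi> a) = \<phi> (md_T M a) \<otimes> p"
    and gamma: "\<phi> (md_mu M \<otimes> md_delta M) \<otimes> p \<otimes> md_T N p = p \<otimes> md_Q N p \<otimes> (md_mu N \<otimes> md_delta N)"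
    and eta: "p \<otimes> md_eta N = \<phi> (md_eta M)" and eps: "\<phi> (md_eps M) \<otimes> p = md_eps N"
    using assms by (auto simp: smm_isomorphism_def smm_of_md_def iso_def hom_def Pi_iff)
  note hom = monoid_homD [OF iso_monoid_hom [OF M.monoid_axioms M.monoid_axioms iso]]
  define u where "u = inv p"
  have cl [simp]: "p \<in> carrier A" "u \<in> carrier A" using p by (auto simp: u_def)
  have pu: "p \<otimes> u = \<one>" "u \<otimes> p = \<one>" using p by (simp_all add: u_def)
  note Qup = N.Q_mult [OF cl(2,1), unfolded pu N.Q_one, symmetric]
  note Tpu = N.T_mult [OF cl, unfolded pu N.T_one, symmetric]
  have Q': "u \<otimes> \<phi> (md_Q M a) = md_Q N (\<phi> a) \<otimes> u" and T': "u \<otimes> \<phi> (md_T M a) = md_T N (\<phi> a) \<otimes> u"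
    if "a \<in> carrier A" for a
    using that Q T p unfolding u_def by (auto intro!: M.Units_swap simp: hom)
  have eps': "md_eps N \<otimes> u = \<phi> (md_eps M)"
    by (simp add: eps [symmetric] M.m_assoc pu hom)
  have eta': "u \<otimes> \<phi> (md_eta M) = md_eta N"
    by (simp add: eta [symmetric] rw [OF pu(2)] hom)
  define g where "g = md_mu N \<otimes> md_delta N"
  have [simp]: "g \<in> carrier A" by (simp add: g_def)
  let ?g = "\<phi> (md_mu M \<otimes> md_delta M)"
  have "md_Q N u \<otimes> u \<otimes> ?g = md_Q N u \<otimes> u \<otimes> (?g \<otimes> p \<otimes> md_T N p) \<otimes> md_T N u \<otimes> u"
    by (simp add: M.m_assoc hom rw [OF Tpu] pu)
  also have "\<dots> = md_Q N u \<otimes> u \<otimes> (p \<otimes> md_Q N p \<otimes> g) \<otimes> md_T N u \<otimes> u"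
    by (simp only: gamma g_def)
  also have "\<dots> = g \<otimes> md_T N u \<otimes> u"
    by (simp add: M.m_assoc rw [OF pu(2)] rw [OF Qup])
  finally have g': "md_Q N u \<otimes> u \<otimes> ?g = g \<otimes> md_T N u \<otimes> u" .
  have "u \<otimes> \<phi> (md_mu M) = u \<otimes> \<phi> (md_Q M (md_eps M) \<otimes> (md_mu M \<otimes> md_delta M))"
    by (simp only: M.mu_from_gamma)
  also have "\<dots> = md_Q N (\<phi> (md_eps M)) \<otimes> u \<otimes> ?g"
    by (simp add: hom(2) [of "md_Q M (md_eps M)"] rw [OF Q'] hom(1) M.m_assoc)
  also have "\<dots> = md_Q N (md_eps N) \<otimes> (md_Q N u \<otimes> u \<otimes> ?g)"
    by (simp add: eps' [symmetric] N.Q_mult M.m_assoc hom)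
  also have "\<dots> = md_Q N (md_eps N) \<otimes> g \<otimes> md_T N u \<otimes> u"
    by (simp add: g' M.m_assoc)
  also have "md_Q N (md_eps N) \<otimes> g = md_mu N"
    by (simp add: g_def N.mu_from_gamma)
  finally have mu': "u \<otimes> \<phi> (md_mu M) = md_mu N \<otimes> md_T N u \<otimes> u" .
  have "md_Q N u \<otimes> u \<otimes> \<phi> (md_delta M) = md_Q N u \<otimes> u \<otimes> \<phi> (md_mu M \<otimes> md_delta M \<otimes> md_T M (md_eta M))"
    by (simp only: M.delta_from_gamma)
  also have "\<dots> = md_Q N u \<otimes> u \<otimes> ?g \<otimes> \<phi> (md_T M (md_eta M))"
    by (subst hom(2)) (simp_all add: hom(1) M.m_assoc)
  also have "\<dots> = g \<otimes> md_T N u \<otimes> (u \<otimes> \<phi> (md_T M (md_eta M)))"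
    unfolding g' by (simp add: M.m_assoc hom)
  also have "\<dots> = g \<otimes> md_T N (u \<otimes> \<phi> (md_eta M)) \<otimes> u"
    by (simp add: T' N.T_mult M.m_assoc hom)
  also have "\<dots> = md_delta N \<otimes> u"
    by (simp add: eta' g_def N.delta_from_gamma)
  finally have delta': "md_Q N u \<otimes> u \<otimes> \<phi> (md_delta M) = md_delta N \<otimes> u" .
  show ?thesis
    unfolding mu_delta_isomorphism_def u_def [symmetric]
    using iso p Q' T' mu' eta' delta' eps' by (simp add: u_def)
qed

lemma smm_isomorphism_iff:
  "(\<exists>\<phi> p q. smm_isomorphism A (smm_of_md A M) A (smm_of_md A N) \<phi> p q) \<longleftrightarrow>
   (\<exists>\<phi> u. mu_delta_isomorphism A M N \<phi> u)"
  using smm_isomorphism_of_mu_delta smm_isomorphism_normalize mu_delta_of_smm_isomorphism by blast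

end

section \<open>Isomorphisms of bialgebroids and the bijection of classes\<close>

lemma bialgebroid_isomorphismD:
  assumes "bialgebroid_isomorphism A G B H \<Phi> \<phi>"
  shows "\<Phi> \<in> iso G H" "\<phi> \<in> iso A B"
    and "\<And>a. a \<in> carrier A \<Longrightarrow> \<Phi> (src G a) = src H (\<phi> a)"
    and "\<And>a. a \<in> carrier A \<Longrightarrow> \<Phi> (tgt G a) = tgt H (\<phi> a)"
    and "\<And>g. g \<in> carrier G \<Longrightarrow> counit H (\<Phi> g) = \<phi> (counit G g)"
    and "\<And>g g\<^sub>1 g\<^sub>2. \<lbrakk>g \<in> carrier G; (g\<^sub>1, g\<^sub>2) \<in> comul G g\<rbrakk> \<Longrightarrow>
      comul H (\<Phi> g) = bialgebroid_tensor B H (\<Phi> g\<^sub>1) (\<Phi> g\<^sub>2)"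
proof -
  show "comul H (\<Phi> g) = bialgebroid_tensor B H (\<Phi> g\<^sub>1) (\<Phi> g\<^sub>2)"
    if "g \<in> carrier G" "(g\<^sub>1, g\<^sub>2) \<in> comul G g" for g g\<^sub>1 g\<^sub>2
  proof -
    have "\<forall>(g\<^sub>1, g\<^sub>2) \<in> comul G g. comul H (\<Phi> g) = bialgebroid_tensor B H (\<Phi> g\<^sub>1) (\<Phi> g\<^sub>2)"
      using assms that(1) unfolding bialgebroid_isomorphism_def by blast
    then show ?thesis using that(2) by blast
  qed
qed (use assms in \<open>simp_all add: bialgebroid_isomorphism_def\<close>)

locale bialgebroid_frame_pair = mu_delta_pair A M N +
  F: bialgebroid_frame A "md_T M" "md_Q M" "md_mu M" "md_eta M" "md_delta M" "md_eps M" G \<theta> +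
  H: bialgebroid_frame A "md_T N" "md_Q N" "md_mu N" "md_eta N" "md_delta N" "md_eps N" H \<psi>
  for A :: "('a, 'm) monoid_scheme" (structure) and M N
    and G :: "('a, 'g) bialgebroid" and \<theta> and H :: "('a, 'h) bialgebroid" and \<psi>
begin

text \<open>\<Phi> is right linear along \<phi>, so it is determined by the coordinate
  \<open>u\<close> of \<open>\<Phi> (\<theta> \<one>)\<close>. The conditions on \<open>u\<close>
  come from evaluating \<Phi> and the structure maps at \<open>\<theta> \<one>\<close>, its products
  and the unit.\<close>

lemma mu_delta_of_bialgebroid_isomorphism:
  assumes "bialgebroid_isomorphism A G A H \<Phi> \<phi>"
  obtains u where "mu_delta_isomorphism A M N \<phi> u"
proof -
  note D = bialgebroid_isomorphismD [OF assms]
  note isoG = D(1) and iso = D(2) and src = D(3) and tgt = D(4) and counit = D(5) and comul = D(6)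
  note hom = monoid_homD [OF iso_monoid_hom [OF M.monoid_axioms M.monoid_axioms iso]]
  note homG = monoid_homD [OF iso_monoid_hom [OF F.monoid_G H.monoid_G isoG]]
  have src_cl: "src G a \<in> carrier G" and tgt_cl: "tgt G a \<in> carrier G" if "a \<in> carrier A" for a
    using that by (simp_all add: F.src_frame F.tgt_frame)
  obtain u where u [simp]: "u \<in> carrier A" and \<Phi>_one: "\<Phi> (\<theta> \<one>) = \<psi> u"
    using homG(1) [of "\<theta> \<one>"] by (auto elim: H.frame_cases)
  have \<Phi>: "\<Phi> (\<theta> a) = \<psi> (u \<otimes> \<phi> a)" if "a \<in> carrier A" for a
  proof -
    have "\<Phi> (\<theta> a) = \<Phi> (\<theta> \<one> \<otimes>\<^bsub>G\<^esub> src G a)" using that by (simp add: F.mult_src_frame)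
    also have "\<dots> = \<psi> (u \<otimes> \<phi> a)"
      using that by (simp add: homG src_cl \<Phi>_one src H.mult_src_frame hom)
    finally show ?thesis .
  qed
  have eq: "a = b" if "\<psi> a = \<psi> b" "a \<in> carrier A" "b \<in> carrier A" for a b
    using that by (simp add: H.B.frame_eq_iff)
  have inj: "inj_on \<Phi> (carrier G)" and surj: "\<Phi> ` carrier G = carrier H"
    using isoG by (auto simp: iso_iff)
  \<comment> \<open>Surjectivity of \<Phi> gives \<open>u\<close> the right inverse
    \<open>\<phi> x\<close>.\<close>
  obtain g where "g \<in> carrier G" "\<Phi> g = \<psi> \<one>"
    using surj H.frame_closed [OF M.one_closed] by (metis imageE)
  then obtain x where x: "x \<in> carrier A" "\<Phi> (\<theta> x) = \<psi> \<one>" by (metis F.frame_cases)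
  then have u_x: "u \<otimes> \<phi> x = \<one>" by (simp add: \<Phi> eq hom)
  \<comment> \<open>Injectivity makes it a left inverse too:
    \<open>u \<otimes> \<phi> y = u\<close>, so \<open>\<theta> y\<close> and
    \<open>\<theta> \<one>\<close> have the same image and \<open>y = \<one>\<close>.\<close>
  obtain y where y: "y \<in> carrier A" "\<phi> y = \<phi> x \<otimes> u"
    using iso x(1) hom(1) u by (metis M.m_closed imageE iso_iff)
  have "\<Phi> (\<theta> y) = \<Phi> (\<theta> \<one>)"
    using x(1) y hom by (simp add: \<Phi> M.m_assoc [symmetric] u_x)
  then have "\<theta> y = \<theta> \<one>" using inj y(1) by (auto dest: inj_onD)
  then have "y = \<one>" using y(1) by (simp add: F.B.frame_eq_iff)
  then have "\<phi> x \<otimes> u = \<one>" using y(2) hom(3) by simp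
  then have unit: "u \<in> Units A" using u_x x(1) hom(1) by (auto simp: Units_def)
  have Q: "u \<otimes> \<phi> (md_Q M a) = md_Q N (\<phi> a) \<otimes> u" if a: "a \<in> carrier A" for a
  proof (rule eq)
    have "\<Phi> (\<theta> \<one> \<otimes>\<^bsub>G\<^esub> tgt G a) = \<psi> (u \<otimes> \<phi> (md_Q M a))"
      using a by (simp add: F.mult_tgt_frame \<Phi>)
    moreover have "\<Phi> (\<theta> \<one> \<otimes>\<^bsub>G\<^esub> tgt G a) = \<psi> (md_Q N (\<phi> a) \<otimes> u)"
      using a by (simp add: homG tgt_cl \<Phi>_one tgt H.mult_tgt_frame hom)
    ultimately show "\<psi> (u \<otimes> \<phi> (md_Q M a)) = \<psi> (md_Q N (\<phi> a) \<otimes> u)" by simp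
  qed (use a hom in simp_all)
  have T: "u \<otimes> \<phi> (md_T M a) = md_T N (\<phi> a) \<otimes> u" if a: "a \<in> carrier A" for a
  proof (rule eq)
    have "\<Phi> (src G a \<otimes>\<^bsub>G\<^esub> \<theta> \<one>) = \<psi> (u \<otimes> \<phi> (md_T M a))"
      using a by (simp add: F.src_mult_frame \<Phi>)
    moreover have "\<Phi> (src G a \<otimes>\<^bsub>G\<^esub> \<theta> \<one>) = \<psi> (md_T N (\<phi> a) \<otimes> u)"
      using a by (simp add: homG src_cl \<Phi>_one src H.src_mult_frame hom)
    ultimately show "\<psi> (u \<otimes> \<phi> (md_T M a)) = \<psi> (md_T N (\<phi> a) \<otimes> u)" by simp
  qed (use a hom in simp_all)
  have eta: "u \<otimes> \<phi> (md_eta M) = md_eta N"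
    by (rule eq) (use homG(3) in \<open>simp_all add: F.one_frame H.one_frame \<Phi> hom\<close>)
  have eps: "md_eps N \<otimes> u = \<phi> (md_eps M)"
    using counit [of "\<theta> \<one>"] by (simp add: \<Phi>_one F.counit_frame H.counit_frame)
  have mu: "u \<otimes> \<phi> (md_mu M) = md_mu N \<otimes> md_T N u \<otimes> u"
  proof (rule eq)
    have "\<Phi> (\<theta> \<one> \<otimes>\<^bsub>G\<^esub> \<theta> \<one>) = \<psi> (u \<otimes> \<phi> (md_mu M))"
      by (simp add: F.mult_frame \<Phi>)
    moreover have "\<Phi> (\<theta> \<one> \<otimes>\<^bsub>G\<^esub> \<theta> \<one>) = \<psi> (md_mu N \<otimes> md_T N u \<otimes> u)"
      by (simp add: homG \<Phi>_one H.mult_frame)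
    ultimately show "\<psi> (u \<otimes> \<phi> (md_mu M)) = \<psi> (md_mu N \<otimes> md_T N u \<otimes> u)" by simp
  qed (simp_all add: hom)
  have delta: "md_Q N u \<otimes> u \<otimes> \<phi> (md_delta M) = md_delta N \<otimes> u"
  proof (rule inj_onD [OF H.B.square.tensor_frame_inj])
    have "(\<theta> \<one>, \<theta> (md_delta M)) \<in> comul G (\<theta> \<one>)"
      by (simp add: F.comul_tensor_frame)
    then have "comul H (\<Phi> (\<theta> \<one>)) = bialgebroid_tensor A H (\<psi> u) (\<psi> (u \<otimes> \<phi> (md_delta M)))"
      using comul [of "\<theta> \<one>" "\<theta> \<one>" "\<theta> (md_delta M)"] by (simp add: \<Phi> hom)
    then show "H.B.square.tensor_frame (md_Q N u \<otimes> u \<otimes> \<phi> (md_delta M))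
        = H.B.square.tensor_frame (md_delta N \<otimes> u)"
      by (simp add: \<Phi>_one H.comul_tensor_frame H.B.square.tensor_class_eq_frame hom M.m_assoc)
  qed (simp_all add: hom)
  show ?thesis
    by (rule that [of u])
      (use iso unit Q T eta eps mu delta in \<open>simp add: mu_delta_isomorphism_def\<close>)
qed

text \<open>Right linearity leaves \<open>\<theta> a \<mapsto> \<psi> (u \<otimes> \<phi> a)\<close>
  as the only candidate; invertibility of \<open>u\<close> makes it bijective.\<close>

lemma bialgebroid_of_mu_delta_isomorphism:
  assumes "mu_delta_isomorphism A M N \<phi> u"
  obtains \<Phi> where "bialgebroid_isomorphism A G A H \<Phi> \<phi>"
proof -
  have iso: "\<phi> \<in> iso A A" and u: "u \<in> Units A"
    and Q: "\<And>a. a \<in> carrier A \<Longrightarrow> u \<otimes> \<phi> (md_Q M a) = md_Q N (\<phi> a) \<otimes> u"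
    and T: "\<And>a. a \<in> carrier A \<Longrightarrow> u \<otimes> \<phi> (md_T M a) = md_T N (\<phi> a) \<otimes> u"
    and mu: "u \<otimes> \<phi> (md_mu M) = md_mu N \<otimes> md_T N u \<otimes> u"
    and eta: "u \<otimes> \<phi> (md_eta M) = md_eta N" and eps: "md_eps N \<otimes> u = \<phi> (md_eps M)"
    and delta: "md_Q N u \<otimes> u \<otimes> \<phi> (md_delta M) = md_delta N \<otimes> u"
    using assms by (auto simp: mu_delta_isomorphism_def)
  note hom = monoid_homD [OF iso_monoid_hom [OF M.monoid_axioms M.monoid_axioms iso]]
  have [simp]: "u \<in> carrier A" using u by auto
  define \<Phi> where "\<Phi> = (\<lambda>g. \<psi> (u \<otimes> \<phi> (inv_into (carrier A) \<theta> g)))"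
  have \<Phi>: "\<Phi> (\<theta> a) = \<psi> (u \<otimes> \<phi> a)" if "a \<in> carrier A" for a
    using that by (simp add: \<Phi>_def bij_betw_inv_into_left [OF F.bij_frame])
  have translate: "bij_betw (\<lambda>a. u \<otimes> a) (carrier A) (carrier A)"
    by (rule bij_betw_byWitness [where f' = "\<lambda>a. inv u \<otimes> a"])
      (use u in \<open>auto simp: M.m_assoc [symmetric]\<close>)
  have "bij_betw (\<psi> \<circ> (\<lambda>a. u \<otimes> a) \<circ> \<phi> \<circ> inv_into (carrier A) \<theta>) (carrier G) (carrier H)"
    using bij_betw_inv_into [OF F.bij_frame] iso translate H.bij_frame
    by (auto simp: iso_def intro!: bij_betw_trans [of _ _ "carrier A"])
  then have bij: "bij_betw \<Phi> (carrier G) (carrier H)" by (simp add: \<Phi>_def comp_def)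
  have mult: "u \<otimes> \<phi> (md_mu M \<otimes> md_T M a \<otimes> b) = md_mu N \<otimes> md_T N (u \<otimes> \<phi> a) \<otimes> (u \<otimes> \<phi> b)"
    if "a \<in> carrier A" "b \<in> carrier A" for a b
  proof -
    have "u \<otimes> \<phi> (md_mu M \<otimes> md_T M a \<otimes> b) = md_mu N \<otimes> md_T N u \<otimes> (u \<otimes> \<phi> (md_T M a)) \<otimes> \<phi> b"
      using that by (simp add: hom rw [OF mu] M.m_assoc)
    also have "\<dots> = md_mu N \<otimes> md_T N (u \<otimes> \<phi> a) \<otimes> (u \<otimes> \<phi> b)"
      unfolding T [OF that(1)] using that by (simp add: hom N.T_mult M.m_assoc)
    finally show ?thesis .
  qed
  have "\<Phi> \<in> iso G H"
  proof -
    have "\<Phi> (g \<otimes>\<^bsub>G\<^esub> h) = \<Phi> g \<otimes>\<^bsub>H\<^esub> \<Phi> h" if "g \<in> carrier G" "h \<in> carrier G" for g h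
      using that mult by (auto elim!: F.frame_cases simp: F.mult_frame H.mult_frame \<Phi> hom)
    then show ?thesis using bij by (auto simp: iso_def hom_def bij_betw_def)
  qed
  moreover have "\<Phi> (src G a) = src H (\<phi> a)" if "a \<in> carrier A" for a
    using that by (simp add: F.src_frame H.src_frame \<Phi> hom rw [OF eta])
  moreover have "\<Phi> (tgt G a) = tgt H (\<phi> a)" if "a \<in> carrier A" for a
    using that by (simp add: F.tgt_frame H.tgt_frame \<Phi> hom rw [OF Q] M.m_assoc eta)
  moreover have "counit H (\<Phi> g) = \<phi> (counit G g)" if "g \<in> carrier G" for g
    using that by (auto elim!: F.frame_cases
        simp: F.counit_frame H.counit_frame \<Phi> hom M.m_assoc [symmetric] eps)
  moreover have "comul H (\<Phi> g) = bialgebroid_tensor A H (\<Phi> g\<^sub>1) (\<Phi> g\<^sub>2)"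
    if "g \<in> carrier G" "(g\<^sub>1, g\<^sub>2) \<in> comul G g" for g g\<^sub>1 g\<^sub>2
  proof -
    obtain a x y where g: "a \<in> carrier A" "x \<in> carrier A" "y \<in> carrier A"
      "g = \<theta> a" "g\<^sub>1 = \<theta> x" "g\<^sub>2 = \<theta> y" "md_Q M x \<otimes> y = md_delta M \<otimes> a"
      using \<open>(g\<^sub>1, g\<^sub>2) \<in> _\<close> \<open>g \<in> _\<close> by (rule F.comulE)
    \<comment> \<open>The invariant of the image pair depends on \<open>x\<close> and
      \<open>y\<close> only through \<open>md_Q M x \<otimes> y\<close>, so the single condition on
      \<delta> serves all representatives.\<close>
    have "md_Q N (u \<otimes> \<phi> x) \<otimes> (u \<otimes> \<phi> y) = md_Q N u \<otimes> (md_Q N (\<phi> x) \<otimes> u) \<otimes> \<phi> y"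
      using g(1-3) by (simp add: N.Q_mult hom M.m_assoc)
    also have "\<dots> = md_Q N u \<otimes> u \<otimes> \<phi> (md_Q M x \<otimes> y)"
      using g(1-3) by (simp add: Q [symmetric] hom M.m_assoc)
    also have "\<dots> = md_Q N u \<otimes> u \<otimes> \<phi> (md_delta M) \<otimes> \<phi> a"
      using g(1-3) by (simp add: g(7) hom M.m_assoc)
    also have "\<dots> = md_delta N \<otimes> (u \<otimes> \<phi> a)"
      unfolding delta using g(1-3) by (simp add: hom M.m_assoc)
    finally show ?thesis
      using g(1-6) by (simp add: \<Phi> hom H.comul_tensor_frame H.B.square.tensor_class_eq_frame)
  qed
  ultimately show ?thesis
    by (intro that [of \<Phi>]) (use iso in \<open>auto simp only: bialgebroid_isomorphism_def\<close>)
qed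

lemma bialgebroid_isomorphism_iff:
  "(\<exists>\<Phi> \<phi>. bialgebroid_isomorphism A G A H \<Phi> \<phi>) \<longleftrightarrow> (\<exists>\<phi> u. mu_delta_isomorphism A M N \<phi> u)"
proof (intro iffI; elim exE)
  show "\<exists>\<phi> u. mu_delta_isomorphism A M N \<phi> u" if "bialgebroid_isomorphism A G A H \<Phi> \<phi>" for \<Phi> \<phi>
    using mu_delta_of_bialgebroid_isomorphism [OF that] by blast
  show "\<exists>\<Phi> \<phi>. bialgebroid_isomorphism A G A H \<Phi> \<phi>" if "mu_delta_isomorphism A M N \<phi> u" for \<phi> u
    using bialgebroid_of_mu_delta_isomorphism [OF that] by blast
qed

end

text \<open>Applied to one tuple with two different frames, this makes the two bialgebroids
  isomorphic.\<close>

lemma mu_delta_isomorphism_refl: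
  assumes "mu_delta_smm A M"
  shows "mu_delta_isomorphism A M M id \<one>\<^bsub>A\<^esub>"
proof -
  interpret mu_delta_monoid A "md_T M" "md_Q M" "md_mu M" "md_eta M" "md_delta M" "md_eps M" by fact
  show ?thesis by (simp add: mu_delta_isomorphism_def id_iso)
qed

section \<open>Identities, composites and inverses of bialgebroid isomorphisms\<close>

lemma tensor_class_self: "(x, y) \<in> tensor_class A X Y x y"
  by (simp add: tensor_class_def)

lemma tensor_class_eqI:
  "(x', y') \<in> tensor_class A X Y x y \<Longrightarrow> tensor_class A X Y x y = tensor_class A X Y x' y'"
  by (auto simp: tensor_class_def intro: equivclp_trans dest: equivclp_sym)

text \<open>The pair of maps preserves generating steps, hence the zigzags that define the classes,
  even if the base monoid changes.\<close>

lemma tensor_class_map: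
  assumes "(x', y') \<in> tensor_class A X Y x y"
    and "\<And>x a y. \<lbrakk>x \<in> points X; a \<in> carrier A; y \<in> points Y\<rbrakk> \<Longrightarrow>
      tensor_step B V W (f (ract X x a), g y) (f x, g (lact Y a y))"
  shows "(f x', g y') \<in> tensor_class B V W (f x) (g y)"
proof -
  have step: "tensor_step B V W (map_prod f g p) (map_prod f g q)" if "tensor_step A X Y p q" for p q
    using that assms(2) by (auto elim!: tensor_step.cases)
  have "equivclp (tensor_step A X Y) (x, y) (x', y')"
    using assms(1) by (simp add: tensor_class_def)
  then have "equivclp (tensor_step B V W) (map_prod f g (x, y)) (map_prod f g (x', y'))"
    by (induction rule: equivclp_induct) (auto intro: step equivclp_into_equivclp)
  then show ?thesis by (simp add: tensor_class_def)
qed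

text \<open>A value of the comultiplication is a point of the tensor square, hence the class of some
  pair, and that pair lies in it. This supplies the representatives over which the Sweedler-style
  conditions quantify.\<close>

lemma (in right_bialgebroid) comul_representatives:
  assumes "g \<in> carrier G"
  obtains g\<^sub>1 g\<^sub>2 where "g\<^sub>1 \<in> carrier G" "g\<^sub>2 \<in> carrier G" "(g\<^sub>1, g\<^sub>2) \<in> comul G g"
    "comul G g = bialgebroid_tensor A G g\<^sub>1 g\<^sub>2"
proof -
  interpret C: biset_comonoid A "bialgebroid_biset G" "comul G" "counit G" by (rule comonoid)
  have "comul G g \<in> points (tensor A (bialgebroid_biset G) (bialgebroid_biset G))"
    using C.comul_hom assms by (simp add: biset_hom_def bialgebroid_biset_def)
  then show ?thesis
    using that tensor_class_self by (fastforce simp: tensor_def bialgebroid_biset_def)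
qed

lemma bialgebroid_isomorphism_refl:
  assumes "right_bialgebroid A G"
  shows "bialgebroid_isomorphism A G A G id id"
proof -
  interpret right_bialgebroid A G by fact
  have "comul G g = bialgebroid_tensor A G g\<^sub>1 g\<^sub>2" if "g \<in> carrier G" "(g\<^sub>1, g\<^sub>2) \<in> comul G g" for g g\<^sub>1 g\<^sub>2
    using that by (metis comul_representatives tensor_class_eqI)
  then show ?thesis by (auto simp: bialgebroid_isomorphism_def id_iso)
qed

lemma bialgebroid_isomorphism_trans:
  assumes "bialgebroid_isomorphism A G B H \<Phi> \<phi>" "bialgebroid_isomorphism B H C K \<Psi> \<psi>"
  shows "bialgebroid_isomorphism A G C K (\<Psi> \<circ> \<Phi>) (\<psi> \<circ> \<phi>)"
proof -
  note D = bialgebroid_isomorphismD [OF assms(1)] and E = bialgebroid_isomorphismD [OF assms(2)]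
  have cl: "\<And>a. a \<in> carrier A \<Longrightarrow> \<phi> a \<in> carrier B" "\<And>g. g \<in> carrier G \<Longrightarrow> \<Phi> g \<in> carrier H"
    using D(1,2) by (auto simp: iso_def hom_def)
  \<comment> \<open>\<open>comul H (\<Phi> g)\<close> is the class of the image pair, so that pair
    is itself a representative to which the condition on \<Psi> applies.\<close>
  have "comul K (\<Psi> (\<Phi> g)) = bialgebroid_tensor C K (\<Psi> (\<Phi> g\<^sub>1)) (\<Psi> (\<Phi> g\<^sub>2))"
    if "g \<in> carrier G" "(g\<^sub>1, g\<^sub>2) \<in> comul G g" for g g\<^sub>1 g\<^sub>2
    using that by (intro E(6)) (simp_all add: cl D(6) [OF that] tensor_class_self)
  then show ?thesis
    using iso_set_trans [OF D(1) E(1)] iso_set_trans [OF D(2) E(2)] D(3-5) E(3-5) cl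
    by (auto simp: bialgebroid_isomorphism_def)
qed

text \<open>For the comultiplication, choose a representative over \<open>\<Psi> h\<close>. Its
  image under \<Phi> lies in the same class as the given pair, and \<open>tensor_class_map\<close>
  carries this relation back along \<Psi>.\<close>

lemma bialgebroid_isomorphism_sym:
  assumes "bialgebroid_isomorphism A G B H \<Phi> \<phi>" "right_bialgebroid A G" "right_bialgebroid B H"
  shows "bialgebroid_isomorphism B H A G (inv_into (carrier G) \<Phi>) (inv_into (carrier A) \<phi>)"
proof -
  interpret G: right_bialgebroid A G by fact
  interpret H: right_bialgebroid B H by fact
  note D = bialgebroid_isomorphismD [OF assms(1)]
  note iso = D(1,2) and src = D(3) and tgt = D(4) and counit = D(5) and comul = D(6)
  define \<Psi> \<psi> where \<Psi>\<psi>: "\<Psi> = inv_into (carrier G) \<Phi>" "\<psi> = inv_into (carrier A) \<phi>"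
  have bij: "bij_betw \<Phi> (carrier G) (carrier H)" "bij_betw \<phi> (carrier A) (carrier B)"
    using iso by (auto simp: iso_def)
  have iso': "\<Psi> \<in> iso H G" "\<psi> \<in> iso B A"
    unfolding \<Psi>\<psi> using iso G.A.monoid_axioms G.G.monoid_axioms by (auto intro: iso_inv_into)
  note left = bij_betw_inv_into_left [OF bij(1), folded \<Psi>\<psi>] bij_betw_inv_into_left [OF bij(2), folded \<Psi>\<psi>]
  note right = bij_betw_inv_into_right [OF bij(1), folded \<Psi>\<psi>] bij_betw_inv_into_right [OF bij(2), folded \<Psi>\<psi>]
  note homH = monoid_homD [OF iso_monoid_hom [OF H.G.monoid_axioms G.G.monoid_axioms iso'(1)]]
  note homB = monoid_homD [OF iso_monoid_hom [OF H.A.monoid_axioms G.A.monoid_axioms iso'(2)]]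
  note src_cl = monoid_homD(1) [OF G.src_hom] monoid_homD(1) [OF H.src_hom]
  have tgt_cl: "\<And>a. a \<in> carrier A \<Longrightarrow> tgt G a \<in> carrier G" "\<And>b. b \<in> carrier B \<Longrightarrow> tgt H b \<in> carrier H"
    using monoid_homD(1) [OF G.tgt_hom] monoid_homD(1) [OF H.tgt_hom] by (simp_all add: op_monoid_def)
  interpret C: biset_comonoid A "bialgebroid_biset G" "comul G" "counit G" by (rule G.comonoid)
  have counit_cl: "counit G g \<in> carrier A" if "g \<in> carrier G" for g
    using C.counit_hom that by (simp add: biset_hom_def bialgebroid_biset_def regular_biset_def)
  have src': "\<Psi> (src H b) = src G (\<psi> b)" and tgt': "\<Psi> (tgt H b) = tgt G (\<psi> b)" if b: "b \<in> carrier B" for b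
  proof -
    have "src H b = \<Phi> (src G (\<psi> b))" "tgt H b = \<Phi> (tgt G (\<psi> b))"
      using b by (simp_all add: src tgt homB right)
    then show "\<Psi> (src H b) = src G (\<psi> b)" "\<Psi> (tgt H b) = tgt G (\<psi> b)"
      using b by (simp_all add: left homB src_cl tgt_cl)
  qed
  have counit': "counit G (\<Psi> h) = \<psi> (counit H h)" if "h \<in> carrier H" for h
    using counit [of "\<Psi> h"] that by (simp add: right left homH counit_cl)
  have comul': "comul G (\<Psi> h) = bialgebroid_tensor A G (\<Psi> h\<^sub>1) (\<Psi> h\<^sub>2)"
    if h: "h \<in> carrier H" "(h\<^sub>1, h\<^sub>2) \<in> comul H h" for h h\<^sub>1 h\<^sub>2
  proof -
    obtain g\<^sub>1 g\<^sub>2 where g: "g\<^sub>1 \<in> carrier G" "g\<^sub>2 \<in> carrier G" "(g\<^sub>1, g\<^sub>2) \<in> comul G (\<Psi> h)"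
      "comul G (\<Psi> h) = bialgebroid_tensor A G g\<^sub>1 g\<^sub>2"
      using G.comul_representatives homH(1) [OF h(1)] by blast
    have "(h\<^sub>1, h\<^sub>2) \<in> bialgebroid_tensor B H (\<Phi> g\<^sub>1) (\<Phi> g\<^sub>2)"
      using comul [OF _ g(3)] h by (simp add: homH right)
    then have "(\<Psi> h\<^sub>1, \<Psi> h\<^sub>2) \<in> bialgebroid_tensor A G (\<Psi> (\<Phi> g\<^sub>1)) (\<Psi> (\<Phi> g\<^sub>2))"
    proof (rule tensor_class_map)
      fix x b y assume xby: "x \<in> points (bialgebroid_biset H)" "b \<in> carrier B" "y \<in> points (bialgebroid_biset H)"
      then have "tensor_step A (bialgebroid_biset G) (bialgebroid_biset G)
          (ract (bialgebroid_biset G) (\<Psi> x) (\<psi> b), \<Psi> y) (\<Psi> x, lact (bialgebroid_biset G) (\<psi> b) (\<Psi> y))"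
        by (intro tensor_step.intros) (simp_all add: bialgebroid_biset_def homH homB)
      then show "tensor_step A (bialgebroid_biset G) (bialgebroid_biset G)
          (\<Psi> (ract (bialgebroid_biset H) x b), \<Psi> y) (\<Psi> x, \<Psi> (lact (bialgebroid_biset H) b y))"
        using xby by (simp add: bialgebroid_biset_def homH src_cl tgt_cl src' tgt')
    qed
    then have "(\<Psi> h\<^sub>1, \<Psi> h\<^sub>2) \<in> bialgebroid_tensor A G g\<^sub>1 g\<^sub>2" using g(1,2) by (simp add: left)
    then show ?thesis unfolding g(4) by (rule tensor_class_eqI)
  qed
  show ?thesis
    unfolding bialgebroid_isomorphism_def \<Psi>\<psi> [symmetric]
    using iso' src' tgt' counit' comul' by blast
qed

lemma equiv_bialgebroid_iso_rel:
  "equiv (source_regular_bialgebroids A) (bialgebroid_iso_rel A)"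
proof (rule equivI)
  show "bialgebroid_iso_rel A \<subseteq> source_regular_bialgebroids A \<times> source_regular_bialgebroids A"
    by (auto simp: bialgebroid_iso_rel_def)
  show "refl_on (source_regular_bialgebroids A) (bialgebroid_iso_rel A)"
    unfolding refl_on_def bialgebroid_iso_rel_def source_regular_bialgebroids_def
    by (blast intro: bialgebroid_isomorphism_refl)
  show "sym (bialgebroid_iso_rel A)"
    unfolding sym_def bialgebroid_iso_rel_def source_regular_bialgebroids_def
    by (blast intro: bialgebroid_isomorphism_sym)
  show "trans (bialgebroid_iso_rel A)"
    unfolding trans_def bialgebroid_iso_rel_def source_regular_bialgebroids_def
    by (blast intro: bialgebroid_isomorphism_trans)
qed

text \<open>The tensor product depends only on the underlying monoid and the source and target maps, so
  the comultiplication can be added to a record in which it is still undefined.\<close>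

definition frame_bialgebroid ::
  "('a, 'm) monoid_scheme \<Rightarrow> 'a smm_md \<Rightarrow> ('a \<Rightarrow> 'g) \<Rightarrow> ('a, 'g) bialgebroid" where
  "frame_bialgebroid A M \<theta> =
     (let \<kappa> = inv_into (carrier A) \<theta>;
        G = \<lparr>carrier = \<theta> ` carrier A,
          mult = (\<lambda>g h. \<theta> (md_mu M \<otimes>\<^bsub>A\<^esub> md_T M (\<kappa> g) \<otimes>\<^bsub>A\<^esub> \<kappa> h)),
          one = \<theta> (md_eta M),
          src = (\<lambda>a. \<theta> (md_eta M \<otimes>\<^bsub>A\<^esub> a)),
          tgt = (\<lambda>a. \<theta> (md_Q M a \<otimes>\<^bsub>A\<^esub> md_eta M)),
          comul = undefined,
          counit = (\<lambda>g. md_eps M \<otimes>\<^bsub>A\<^esub> \<kappa> g)\<rparr>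
      in G\<lparr>comul := \<lambda>g. bialgebroid_tensor A G (\<theta> \<one>\<^bsub>A\<^esub>) (\<theta> (md_delta M \<otimes>\<^bsub>A\<^esub> \<kappa> g))\<rparr>)"

lemma bialgebroid_frame_frame_bialgebroid:
  assumes "mu_delta_smm A M" "inj_on \<theta> (carrier A)"
  shows "bialgebroid_frame A (md_T M) (md_Q M) (md_mu M) (md_eta M) (md_delta M) (md_eps M)
    (frame_bialgebroid A M \<theta>) \<theta>"
proof -
  interpret mu_delta_monoid A "md_T M" "md_Q M" "md_mu M" "md_eta M" "md_delta M" "md_eps M" by fact
  show ?thesis
    by unfold_locales
      (simp_all add: frame_bialgebroid_def Let_def bialgebroid_biset_def assms(2) inj_on_imp_bij_betw)
qed

text \<open>\<open>f\<close> preserves and reflects the relations and meets every class of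
  \<open>s\<close>. The image of a class lies inside one class of \<open>s\<close> but may fail to
  fill it, hence the closure under \<open>s\<close>.\<close>

lemma bij_betw_quotients:
  assumes s: "equiv Y s" and f: "\<And>x. x \<in> X \<Longrightarrow> f x \<in> Y"
    and r: "r = {(x, x'). x \<in> X \<and> x' \<in> X \<and> (f x, f x') \<in> s}"
    and surj: "\<And>y. y \<in> Y \<Longrightarrow> \<exists>x \<in> X. (f x, y) \<in> s"
  shows "bij_betw (\<lambda>C. s `` (f ` C)) (X // r) (Y // s)"
proof -
  have image: "s `` (f ` (r `` {x})) = s `` {f x}" if "x \<in> X" for x
    using that f s unfolding r by (auto simp: equiv_def refl_on_def dest: transD symD)
  have classes: "r `` {x} = r `` {x'}" if "s `` {f x} = s `` {f x'}" "x \<in> X" "x' \<in> X" for x x'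
    using that s unfolding r by (auto simp: equiv_def dest: transD symD)
  show ?thesis
  proof (rule bij_betw_imageI)
    show "inj_on (\<lambda>C. s `` (f ` C)) (X // r)"
      by (rule inj_onI) (metis (no_types, lifting) classes image quotientE)
    have "s `` {y} \<in> (\<lambda>C. s `` (f ` C)) ` (X // r)" if y: "y \<in> Y" for y
    proof -
      obtain x where "x \<in> X" "(f x, y) \<in> s" using surj [OF y] by blast
      then show ?thesis
        using equiv_class_eq [OF s] by (intro image_eqI [where x = "r `` {x}"]) (auto simp: image quotientI)
    qed
    then show "(\<lambda>C. s `` (f ` C)) ` (X // r) = Y // s"
      using f by (auto elim!: quotientE simp: image quotientI)
  qed
qed

theorem theorem4p3:
  fixes A :: "('a, 'm) monoid_scheme"
  assumes "monoid A"
    and "carrier A \<lesssim> (UNIV :: 'g set)"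
  shows "\<exists>F. bij_betw F (smm_iso_classes A)
               (bialgebroid_iso_classes A :: ('a, 'g) bialgebroid set set)"
proof -
  \<comment> \<open>A single embedding serves as the frame of all constructed bialgebroids.\<close>
  obtain e :: "'a \<Rightarrow> 'g" where e: "inj_on e (carrier A)"
    using assms(2) by (auto simp: lepoll_def)
  let ?f = "\<lambda>M. frame_bialgebroid A M e"
  have frame: "bialgebroid_frame A (md_T M) (md_Q M) (md_mu M) (md_eta M) (md_delta M) (md_eps M) (?f M) e"
    if "M \<in> smm_mds A" for M
    using that e by (simp add: smm_mds_iff bialgebroid_frame_frame_bialgebroid)
  have f: "?f M \<in> source_regular_bialgebroids A" if "M \<in> smm_mds A" for M
    using frame [OF that]
    by (simp add: source_regular_bialgebroids_def bialgebroid_frame.right_bialgebroid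
        bialgebroid_frame.source_regular)
  have rel: "(\<exists>\<phi> p q. smm_isomorphism A (smm_of_md A M) A (smm_of_md A N) \<phi> p q) \<longleftrightarrow>
      (\<exists>\<Phi> \<phi>. bialgebroid_isomorphism A (?f M) A (?f N) \<Phi> \<phi>)"
    if "M \<in> smm_mds A" "N \<in> smm_mds A" for M N
  proof -
    interpret P: bialgebroid_frame_pair A M N "?f M" e "?f N" e
      using frame [OF that(1)] frame [OF that(2)]
      by (simp add: bialgebroid_frame_pair_def mu_delta_pair_def bialgebroid_frame_def)
    show ?thesis by (simp add: P.smm_isomorphism_iff P.bialgebroid_isomorphism_iff)
  qed
  have surj: "\<exists>M \<in> smm_mds A. (?f M, G) \<in> bialgebroid_iso_rel A"
    if G: "G \<in> source_regular_bialgebroids A" for G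
  proof -
    obtain T Q \<mu> \<eta> \<delta> \<epsilon> \<theta> where F: "bialgebroid_frame A T Q \<mu> \<eta> \<delta> \<epsilon> G \<theta>"
      using G bialgebroid_frame_exists [of A G] unfolding source_regular_bialgebroids_def by blast
    define M where "M = \<lparr>md_T = T, md_Q = Q, md_mu = \<mu>, md_eta = \<eta>, md_delta = \<delta>, md_eps = \<epsilon>\<rparr>"
    have M: "M \<in> smm_mds A"
      using F by (simp add: smm_mds_iff M_def bialgebroid_frame_def)
    have refl: "mu_delta_isomorphism A M M id \<one>\<^bsub>A\<^esub>"
      using M by (simp add: smm_mds_iff mu_delta_isomorphism_refl)
    \<comment> \<open>\<open>?f M\<close> and \<open>G\<close> have the frames \<open>e\<close> and
      \<theta> over the same tuple \<open>M\<close>, so the identity of \<open>M\<close> yields an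
      isomorphism between them.\<close>
    interpret P: bialgebroid_frame_pair A M M "?f M" e G \<theta>
      using frame [OF M] F
      by (simp add: bialgebroid_frame_pair_def mu_delta_pair_def bialgebroid_frame_def M_def)
    show ?thesis
      using M G f [OF M] P.bialgebroid_isomorphism_iff refl
      by (auto simp: bialgebroid_iso_rel_def)
  qed
  have "bij_betw (\<lambda>C. bialgebroid_iso_rel A `` (?f ` C)) (smm_iso_classes A) (bialgebroid_iso_classes A)"
    unfolding smm_iso_classes_def bialgebroid_iso_classes_def
  proof (rule bij_betw_quotients [OF equiv_bialgebroid_iso_rel f _ surj])
    have "(M, N) \<in> smm_iso_rel A \<longleftrightarrow>
        M \<in> smm_mds A \<and> N \<in> smm_mds A \<and> (?f M, ?f N) \<in> bialgebroid_iso_rel A" for M N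
      using rel [of M N] f [of M] f [of N] unfolding smm_iso_rel_def bialgebroid_iso_rel_def by blast
    then show "smm_iso_rel A = {(M, N). M \<in> smm_mds A \<and> N \<in> smm_mds A \<and> (?f M, ?f N) \<in> bialgebroid_iso_rel A}"
      by auto
  qed
  then show ?thesis by blast
qed

end
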